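(* Let $\mathcal{F}$ be the Fourier transform on $L^2(\mathbb{R})$, normalized as the unitary operator extending $\mathcal{F}f(\xi)=\frac{1}{\sqrt{2\pi}}\int_{\mathbb{R}}f(x)e^{-ix\xi}\,dx$. Let $A$ be the operator on $L^2(\mathbb{R})$ defined by $Af(x)=e^{\frac{x^2}{2}}f(x)$ on the domain $D(A)=\{f\in L^2(\mathbb{R}): e^{\frac{x^2}{2}}f\in L^2(\mathbb{R})\}$, let $B:=\mathcal{F}^*A\mathcal{F}$, and let $T:=A^{-1}B$. Then $T$ is a densely defined linear operator on $L^2(\mathbb{R})$ satisfying $D(T^2)=D(T^* )=\{0\}$; moreover, $T$ is paranormal and $T$ is not closable. In particular, there exists a densely defined paranormal operator that is not closable and whose adjoint has trivial domain.
   Context: $L^2(\mathbb{R})$ is the complex Hilbert space of square-integrable functions. Linear operators are not necessarily bounded and are defined on a linear subspace $D(\cdot)$ (the domain) of a Hilbert space $H$. Products have their natural domains: $D(ST)=\{x\in D(T): Tx\in D(S)\}$; in particular $D(T^2)=\{x\in D(T): Tx\in D(T)\}$. Thus $D(B)=\{f\in L^2(\mathbb{R}):\mathcal{F}f\in D(A)\}$, and $D(T)=\{f\in D(B): Bf\in D(A^{-1})\}$, where $A^{-1}$ is the inverse of the injective operator $A$ (multiplication by $e^{-x^2/2}$). An operator $T$ is densely defined if $D(T)$ is dense in $H$; $T^*$ is its adjoint. An operator is closed if its graph is closed in $H\oplus H$. We write $A_1\subset A_2$ ($A_2$ extends $A_1$) if $D(A_1)\subset D(A_2)$ and the operators agree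 on $D(A_1)$. An operator is closable if it has a closed extension. A linear operator $T:D(T)\subset H\to H$ is called paranormal if $\|Tx\|^2\leq\|T^2x\|\,\|x\|$ for all $x\in D(T^2)$. *)

theory Defs
  imports "HOL-Analysis.Analysis"
begin

section \<open>Complex Hilbert spaces\<close>

class complex_inner_space = real_normed_vector +
  fixes scaleC :: "complex \<Rightarrow> 'a \<Rightarrow> 'a"  (infixr \<open>*\<^sub>C\<close> 75)
    and cinner :: "'a \<Rightarrow> 'a \<Rightarrow> complex"
  assumes scaleR_scaleC: "scaleR r x = complex_of_real r *\<^sub>C x"
    and scaleC_add_right: "c *\<^sub>C (x + y) = c *\<^sub>C x + c *\<^sub>C y"
    and scaleC_add_left: "(c + d) *\<^sub>C x = c *\<^sub>C x + d *\<^sub>C x"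
    and scaleC_scaleC: "c *\<^sub>C (d *\<^sub>C x) = (c * d) *\<^sub>C x"
    and cinner_commute: "cinner x y = cnj (cinner y x)"
    and cinner_add_left: "cinner (x + y) z = cinner x z + cinner y z"
    and cinner_scaleC_left: "cinner (c *\<^sub>C x) y = c * cinner x y"
    and cinner_self: "cinner x x = complex_of_real ((norm x)\<^sup>2)"

class complex_hilbert_space = complex_inner_space + complete_space


section \<open>Unbounded linear operators\<close>

text \<open>An operator is given by its domain together with a function of which only the values on
  the domain matter. Equality of such pairs is therefore finer than equality of operators and is
  not used below; operators are compared by \<open>extends\<close>.\<close>

datatype 'h operator = Operator (op_dom: "'h set") (op_app: "'h \<Rightarrow> 'h")

definition csubspace :: "'h::complex_hilbert_space set \<Rightarrow> bool" where
  "csubspace S \<longleftrightarrow> 0 \<in> S \<and> (\<forall>x\<in>S. \<forall>y\<in>S. x + y \<in> S) \<and> (\<forall>c. \<forall>x\<in>S. c *\<^sub>C x \<in> S)"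

definition linear_operator :: "'h::complex_hilbert_space operator \<Rightarrow> bool" where
  "linear_operator T \<longleftrightarrow> csubspace (op_dom T) \<and>
     (\<forall>x\<in>op_dom T. \<forall>y\<in>op_dom T. op_app T (x + y) = op_app T x + op_app T y) \<and>
     (\<forall>c. \<forall>x\<in>op_dom T. op_app T (c *\<^sub>C x) = c *\<^sub>C op_app T x)"

definition op_mult :: "'h operator \<Rightarrow> 'h operator \<Rightarrow> 'h operator"  (infixl \<open>\<circ>\<^sub>o\<close> 70) where
  "S \<circ>\<^sub>o T = Operator {x \<in> op_dom T. op_app T x \<in> op_dom S} (\<lambda>x. op_app S (op_app T x))"

text \<open>Meaningful for \<open>T\<close> injective on its domain.\<close>

definition op_inverse :: "'h operator \<Rightarrow> 'h operator" where
  "op_inverse T = Operator (op_app T ` op_dom T) (inv_into (op_dom T) (op_app T))"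

definition densely_defined :: "'h::complex_hilbert_space operator \<Rightarrow> bool" where
  "densely_defined T \<longleftrightarrow> closure (op_dom T) = UNIV"

text \<open>For densely defined \<open>T\<close> the vector \<open>z\<close> is unique.\<close>

definition op_adjoint :: "'h::complex_hilbert_space operator \<Rightarrow> 'h operator" where
  "op_adjoint T =
     Operator {y. \<exists>z. \<forall>x\<in>op_dom T. cinner (op_app T x) y = cinner x z}
       (\<lambda>y. THE z. \<forall>x\<in>op_dom T. cinner (op_app T x) y = cinner x z)"

definition op_graph :: "'h operator \<Rightarrow> ('h \<times> 'h) set" where
  "op_graph T = {(x, op_app T x) | x. x \<in> op_dom T}"

text \<open>The norm on the product type is the Hilbert norm of the orthogonal sum.\<close>

definition closed_operator :: "'h::complex_hilbert_space operator \<Rightarrow> bool" where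
  "closed_operator T \<longleftrightarrow> closed (op_graph T)"

definition extends :: "'h operator \<Rightarrow> 'h operator \<Rightarrow> bool" where
  "extends S T \<longleftrightarrow> op_dom T \<subseteq> op_dom S \<and> (\<forall>x\<in>op_dom T. op_app S x = op_app T x)"

definition closable :: "'h::complex_hilbert_space operator \<Rightarrow> bool" where
  "closable T \<longleftrightarrow> (\<exists>S. linear_operator S \<and> closed_operator S \<and> extends S T)"

definition paranormal :: "'h::complex_hilbert_space operator \<Rightarrow> bool" where
  "paranormal T \<longleftrightarrow>
     (\<forall>x\<in>op_dom (T \<circ>\<^sub>o T). (norm (op_app T x))\<^sup>2 \<le> norm (op_app (T \<circ>\<^sub>o T) x) * norm x)"

definition unitary :: "('h::complex_hilbert_space \<Rightarrow> 'h) \<Rightarrow> bool" where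
  "unitary U \<longleftrightarrow> (\<forall>x y. U (x + y) = U x + U y) \<and> (\<forall>c x. U (c *\<^sub>C x) = c *\<^sub>C U x) \<and>
     (\<forall>x y. cinner (U x) (U y) = cinner x y) \<and> surj U"


section \<open>The space of square-integrable functions on the real line\<close>

definition sq_integrable :: "(real \<Rightarrow> complex) \<Rightarrow> bool" where
  "sq_integrable f \<longleftrightarrow>
     f \<in> borel_measurable lborel \<and> integrable lborel (\<lambda>x. (cmod (f x))\<^sup>2)"

lemma sq_integrable_zero: "sq_integrable (\<lambda>x. 0)"
  by (simp add: sq_integrable_def)

lemma sq_integrable_scale: "sq_integrable f \<Longrightarrow> sq_integrable (\<lambda>x. c * f x)"
  by (auto simp: sq_integrable_def norm_mult power_mult_distrib)

lemma sq_integrable_add: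
  assumes "sq_integrable f" "sq_integrable g"
  shows "sq_integrable (\<lambda>x. f x + g x)"
  unfolding sq_integrable_def
proof
  have m: "f \<in> borel_measurable lborel" "g \<in> borel_measurable lborel"
    using assms by (auto simp: sq_integrable_def)
  then show "(\<lambda>x. f x + g x) \<in> borel_measurable lborel" by simp
  have b: "(cmod (f x + g x))\<^sup>2 \<le> 2 * (cmod (f x))\<^sup>2 + 2 * (cmod (g x))\<^sup>2" for x
  proof -
    have "(cmod (f x + g x))\<^sup>2 \<le> (cmod (f x) + cmod (g x))\<^sup>2"
      by (intro power_mono norm_triangle_ineq) auto
    also have "\<dots> \<le> 2 * (cmod (f x))\<^sup>2 + 2 * (cmod (g x))\<^sup>2"
      using zero_le_power2[of "cmod (f x) - cmod (g x)"]
      by (simp add: power2_sum power2_diff)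
    finally show ?thesis .
  qed
  show "integrable lborel (\<lambda>x. (cmod (f x + g x))\<^sup>2)"
    by (rule Bochner_Integration.integrable_bound
        [where f = "\<lambda>x. 2 * (cmod (f x))\<^sup>2 + 2 * (cmod (g x))\<^sup>2"])
      (use assms m b in \<open>auto simp: sq_integrable_def\<close>)
qed

lemma sq_integrable_uminus: "sq_integrable f \<Longrightarrow> sq_integrable (\<lambda>x. - f x)"
  by (simp add: sq_integrable_def)

lemma sq_integrable_diff:
  "sq_integrable f \<Longrightarrow> sq_integrable g \<Longrightarrow> sq_integrable (\<lambda>x. f x - g x)"
  using sq_integrable_add[of f "\<lambda>x. - g x"] sq_integrable_uminus[of g] by simp

lemma integrable_mult_cnj:
  assumes "sq_integrable f" "sq_integrable g"
  shows "integrable lborel (\<lambda>x. f x * cnj (g x))"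
proof (rule Bochner_Integration.integrable_bound
    [where f = "\<lambda>x. (cmod (f x))\<^sup>2 + (cmod (g x))\<^sup>2"])
  have m: "f \<in> borel_measurable lborel" "g \<in> borel_measurable lborel"
    using assms by (auto simp: sq_integrable_def)
  have "(\<lambda>x. cnj (g x)) \<in> borel_measurable lborel"
    using m(2)
    by (rule borel_measurable_continuous_on[rotated]) (rule continuous_on_cnj, rule continuous_on_id)
  then show "(\<lambda>x. f x * cnj (g x)) \<in> borel_measurable lborel" using m by simp
  show "integrable lborel (\<lambda>x. (cmod (f x))\<^sup>2 + (cmod (g x))\<^sup>2)"
    using assms by (auto simp: sq_integrable_def)
  have "cmod (f x) * cmod (g x) \<le> (cmod (f x))\<^sup>2 + (cmod (g x))\<^sup>2" for x
  proof -
    have "2 * (cmod (f x) * cmod (g x)) \<le> (cmod (f x))\<^sup>2 + (cmod (g x))\<^sup>2"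
      using sum_squares_bound[of "cmod (f x)" "cmod (g x)"] by (simp add: mult.assoc)
    moreover have "0 \<le> cmod (f x) * cmod (g x)"
      by simp
    ultimately show ?thesis by linarith
  qed
  then show "AE x in lborel. norm (f x * cnj (g x)) \<le> norm ((cmod (f x))\<^sup>2 + (cmod (g x))\<^sup>2)"
    by (auto simp: norm_mult)
qed

lemma integral_mult_cnj_cong:
  assumes f: "sq_integrable f \<and> sq_integrable f' \<and> (AE x in lborel. f x = f' x)"
    and g: "sq_integrable g \<and> sq_integrable g' \<and> (AE x in lborel. g x = g' x)"
  shows "(LINT x|lborel. f x * cnj (g x)) = (LINT x|lborel. f' x * cnj (g' x))"
proof (rule integral_cong_AE)
  show "(\<lambda>x. f x * cnj (g x)) \<in> borel_measurable lborel"
    "(\<lambda>x. f' x * cnj (g' x)) \<in> borel_measurable lborel"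
    using f g by (blast intro: borel_measurable_integrable integrable_mult_cnj)+
  show "AE x in lborel. f x * cnj (g x) = f' x * cnj (g' x)"
    using f g by (auto elim: eventually_elim2)
qed

lemma integral_mult_cnj_self:
  "(LINT x|lborel. f x * cnj (f x)) = complex_of_real (LINT x|lborel. (cmod (f x))\<^sup>2)"
  by (simp flip: complex_norm_square integral_complex_of_real)

quotient_type L2 = "real \<Rightarrow> complex" / partial:
  "\<lambda>f g. sq_integrable f \<and> sq_integrable g \<and> (AE x in lborel. f x = g x)"
proof (rule part_equivpI)
  show "\<exists>f. sq_integrable f \<and> sq_integrable f \<and> (AE x in lborel. f x = f x)"
    using sq_integrable_zero by auto
  show "symp (\<lambda>f g. sq_integrable f \<and> sq_integrable g \<and> (AE x in lborel. f x = g x))"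
    by (auto simp: symp_def elim: eventually_mono)
  show "transp (\<lambda>f g. sq_integrable f \<and> sq_integrable g \<and> (AE x in lborel. f x = g x))"
    by (auto simp: transp_def elim: eventually_elim2)
qed

instantiation L2 :: real_inner
begin

lift_definition zero_L2 :: L2 is "\<lambda>x. 0"
  by (simp add: sq_integrable_zero)

lift_definition plus_L2 :: "L2 \<Rightarrow> L2 \<Rightarrow> L2" is "\<lambda>f g x. f x + g x"
  by (auto intro: sq_integrable_add)

lift_definition minus_L2 :: "L2 \<Rightarrow> L2 \<Rightarrow> L2" is "\<lambda>f g x. f x - g x"
  by (auto intro: sq_integrable_diff)

lift_definition uminus_L2 :: "L2 \<Rightarrow> L2" is "\<lambda>f x. - f x"
  by (auto intro: sq_integrable_uminus)

lift_definition scaleR_L2 :: "real \<Rightarrow> L2 \<Rightarrow> L2" is "\<lambda>r f x. complex_of_real r * f x"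
  by (auto intro: sq_integrable_scale)

lift_definition inner_L2 :: "L2 \<Rightarrow> L2 \<Rightarrow> real" is "\<lambda>f g. Re (LINT x|lborel. f x * cnj (g x))"
  by (rule arg_cong[where f = Re], rule integral_mult_cnj_cong)

definition norm_L2 :: "L2 \<Rightarrow> real" where
  "norm_L2 f = sqrt (inner f f)"

definition dist_L2 :: "L2 \<Rightarrow> L2 \<Rightarrow> real" where
  "dist_L2 f g = norm (f - g)"

definition sgn_L2 :: "L2 \<Rightarrow> L2" where
  "sgn_L2 f = inverse (norm f) *\<^sub>R f"

definition uniformity_L2 :: "(L2 \<times> L2) filter" where
  "uniformity_L2 = (INF e\<in>{0 <..}. principal {(f, g). dist f g < e})"

definition open_L2 :: "L2 set \<Rightarrow> bool" where
  "open_L2 U \<longleftrightarrow> (\<forall>f\<in>U. eventually (\<lambda>(f', g). f' = f \<longrightarrow> g \<in> U) uniformity)"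

instance
proof
  fix f g h :: L2 and a b :: real and U :: "L2 set"
  show "f + g + h = f + (g + h)"
    by transfer (auto intro: sq_integrable_add simp: add.assoc)
  show "f + g = g + f"
    by transfer (auto intro: sq_integrable_add simp: add.commute)
  show "0 + f = f"
    by transfer auto
  show "- f + f = 0"
    by transfer (auto intro: sq_integrable_zero)
  show "f - g = f + - g"
    by transfer (auto intro: sq_integrable_diff)
  show "a *\<^sub>R (f + g) = a *\<^sub>R f + a *\<^sub>R g"
    by transfer (auto intro!: sq_integrable_add sq_integrable_scale simp: distrib_left)
  show "(a + b) *\<^sub>R f = a *\<^sub>R f + b *\<^sub>R f"
    by transfer (auto intro!: sq_integrable_add sq_integrable_scale simp: distrib_right)
  show "a *\<^sub>R b *\<^sub>R f = (a * b) *\<^sub>R f"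
    by transfer (auto intro!: sq_integrable_scale simp: mult.assoc)
  show "1 *\<^sub>R f = f"
    by transfer auto
  show "sgn f = inverse (norm f) *\<^sub>R f"
    by (rule sgn_L2_def)
  show "dist f g = norm (f - g)"
    by (rule dist_L2_def)
  show "uniformity = (INF e\<in>{0 <..}. principal {(f, g :: L2). dist f g < e})"
    by (rule uniformity_L2_def)
  show "open U \<longleftrightarrow> (\<forall>f\<in>U. eventually (\<lambda>(f', g). f' = f \<longrightarrow> g \<in> U) uniformity)"
    by (rule open_L2_def)
  show "inner f g = inner g f"
  proof transfer
    fix f g :: "real \<Rightarrow> complex"
    have "(LINT x|lborel. f x * cnj (g x)) = cnj (LINT x|lborel. g x * cnj (f x))"
      by (simp flip: Bochner_Integration.integral_cnj add: mult.commute)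
    then show "Re (LINT x|lborel. f x * cnj (g x)) = Re (LINT x|lborel. g x * cnj (f x))"
      by simp
  qed
  show "inner (f + g) h = inner f h + inner g h"
    by transfer (simp add: distrib_right Bochner_Integration.integral_add integrable_mult_cnj)
  show "inner (a *\<^sub>R f) g = a * inner f g"
    by transfer (simp add: mult.assoc)
  show "0 \<le> inner f f"
    by transfer (simp add: integral_mult_cnj_self)
  show "inner f f = 0 \<longleftrightarrow> f = 0"
  proof (transfer, elim conjE)
    fix f :: "real \<Rightarrow> complex"
    assume f: "sq_integrable f"
    then have i: "integrable lborel (\<lambda>x. (cmod (f x))\<^sup>2)"
      by (simp add: sq_integrable_def)
    have "(LINT x|lborel. (cmod (f x))\<^sup>2) = 0 \<longleftrightarrow> (AE x in lborel. f x = 0)"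
      using integral_nonneg_eq_0_iff_AE[OF i] by simp
    then show "(Re (LINT x|lborel. f x * cnj (f x)) = 0) =
        (sq_integrable f \<and> sq_integrable (\<lambda>x. 0) \<and> (AE x in lborel. f x = 0))"
      using f by (simp add: integral_mult_cnj_self sq_integrable_zero)
  qed
  show "norm f = sqrt (inner f f)"
    by (rule norm_L2_def)
qed

end

instantiation L2 :: complex_inner_space
begin

lift_definition scaleC_L2 :: "complex \<Rightarrow> L2 \<Rightarrow> L2" is "\<lambda>c f x. c * f x"
  by (auto intro: sq_integrable_scale)

lift_definition cinner_L2 :: "L2 \<Rightarrow> L2 \<Rightarrow> complex" is "\<lambda>f g. LINT x|lborel. f x * cnj (g x)"
  by (rule integral_mult_cnj_cong)

instance
proof
  fix f g h :: L2 and a b :: real and c d :: complex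
  show "c *\<^sub>C (f + g) = c *\<^sub>C f + c *\<^sub>C g"
    by transfer (auto intro!: sq_integrable_add sq_integrable_scale simp: distrib_left)
  show "(c + d) *\<^sub>C f = c *\<^sub>C f + d *\<^sub>C f"
    by transfer (auto intro!: sq_integrable_add sq_integrable_scale simp: distrib_right)
  show "c *\<^sub>C d *\<^sub>C f = (c * d) *\<^sub>C f"
    by transfer (auto intro!: sq_integrable_scale simp: mult.assoc)
  show "a *\<^sub>R f = complex_of_real a *\<^sub>C f"
    by transfer (auto intro!: sq_integrable_scale)
  show "cinner f g = cnj (cinner g f)"
    by transfer (simp flip: Bochner_Integration.integral_cnj add: mult.commute)
  show "cinner (f + g) h = cinner f h + cinner g h"
    by transfer (simp add: distrib_right Bochner_Integration.integral_add integrable_mult_cnj)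
  show "cinner (c *\<^sub>C f) g = c * cinner f g"
    by transfer (simp add: mult.assoc)
  have "cinner f f = complex_of_real (inner f f)"
    by transfer (simp add: integral_mult_cnj_self)
  then show "cinner f f = complex_of_real ((norm f)\<^sup>2)"
    by (simp add: dot_square_norm)
qed

end

lemma L2_cases:
  obtains f where "sq_integrable f" "F = abs_L2 f"
  using Quotient_L2 unfolding Quotient_def by metis

lemma norm_abs_L2:
  assumes "sq_integrable f"
  shows "(norm (abs_L2 f))\<^sup>2 = (LINT x|lborel. (cmod (f x))\<^sup>2)"
proof -
  have "complex_of_real ((norm (abs_L2 f))\<^sup>2) = cinner (abs_L2 f) (abs_L2 f)"
    by (simp add: cinner_self)
  also have "\<dots> = (LINT x|lborel. f x * cnj (f x))"
    using assms by (simp add: cinner_L2.abs_eq)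
  also have "\<dots> = complex_of_real (LINT x|lborel. (cmod (f x))\<^sup>2)"
    by (rule integral_mult_cnj_self)
  finally show ?thesis
    using of_real_eq_iff by blast
qed

lemma nn_integral_norm_abs_L2:
  assumes "sq_integrable f" 
  shows "(\<integral>\<^sup>+x. ennreal ((cmod (f x))\<^sup>2) \<partial>lborel) = ennreal ((norm (abs_L2 f))\<^sup>2)"
  using assms by (simp add: norm_abs_L2 nn_integral_eq_integral sq_integrable_def)

instance L2 :: complex_hilbert_space
proof
  fix X :: "nat \<Rightarrow> L2"
  assume X: "Cauchy X"
  have "\<exists>N. \<forall>m\<ge>N. \<forall>n\<ge>N. dist (X m) (X n) < (1/2)^k" for k
    using X unfolding Cauchy_def by simp
  then obtain N where N: "\<And>k m n. m \<ge> N k \<Longrightarrow> n \<ge> N k \<Longrightarrow> dist (X m) (X n) < (1/2)^k"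
    by metis
  define r where "r k = (\<Sum>i\<le>k. N i) + k" for k
  have rN: "r m \<ge> N k" if "k \<le> m" for k m
    using member_le_sum[of k "{..m}" N] that by (auto simp: r_def)
  have r: "strict_mono r"
    by (rule strict_monoI_Suc) (simp add: r_def)
  have "\<exists>g. \<forall>n. sq_integrable (g n) \<and> X (r n) = abs_L2 (g n)"
    by (intro choice allI) (metis L2_cases)
  then obtain g where g: "\<And>n. sq_integrable (g n)" "\<And>n. X (r n) = abs_L2 (g n)"
    by blast
  have gm [measurable]: "g n \<in> borel_measurable lborel" for n
    using g(1) by (simp add: sq_integrable_def)
  have near: "(\<integral>\<^sup>+x. ennreal ((cmod (g m x - g n x))\<^sup>2) \<partial>lborel) \<le> ennreal ((1/4)^k)"
    if "k \<le> m" "k \<le> n" for m n k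
  proof -
    have "abs_L2 (\<lambda>x. g m x - g n x) = X (r m) - X (r n)"
      using g by (simp add: minus_L2.abs_eq)
    moreover have "norm (X (r m) - X (r n)) \<le> (1/2)^k"
      using N[of k "r m" "r n"] rN[of k] that by (simp add: dist_norm less_imp_le)
    then have "(norm (X (r m) - X (r n)))\<^sup>2 \<le> ((1/2)^k)\<^sup>2"
      by (intro power_mono) auto
    then have "(norm (X (r m) - X (r n)))\<^sup>2 \<le> (1/4)^k"
      by (simp add: power2_eq_square flip: power_mult_distrib)
    ultimately show ?thesis
      using nn_integral_norm_abs_L2[OF sq_integrable_diff[OF g(1) g(1)], of m n]
      by (simp add: ennreal_leI)
  qed
  have "(\<integral>\<^sup>+x. (\<Sum>n. ennreal (2^n * (cmod (g (Suc n) x - g n x))\<^sup>2)) \<partial>lborel)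
      = (\<Sum>n. \<integral>\<^sup>+x. ennreal (2^n * (cmod (g (Suc n) x - g n x))\<^sup>2) \<partial>lborel)"
    by (rule nn_integral_suminf) measurable
  also have "\<dots> \<le> (\<Sum>n. ennreal ((1/2)^n))"
  proof (intro suminf_le summableI)
    fix n
    have "(\<integral>\<^sup>+x. ennreal (2^n * (cmod (g (Suc n) x - g n x))\<^sup>2) \<partial>lborel)
       = ennreal (2^n) * (\<integral>\<^sup>+x. ennreal ((cmod (g (Suc n) x - g n x))\<^sup>2) \<partial>lborel)"
      by (simp add: ennreal_mult nn_integral_cmult)
    also have "\<dots> \<le> ennreal (2^n) * ennreal ((1/4)^n)"
      by (intro mult_left_mono near) auto
    also have "\<dots> = ennreal ((1/2)^n)"
      by (simp flip: ennreal_mult power_mult_distrib)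
    finally show "(\<integral>\<^sup>+x. ennreal (2^n * (cmod (g (Suc n) x - g n x))\<^sup>2) \<partial>lborel)
        \<le> ennreal ((1/2)^n)" .
  qed
  also have "\<dots> = ennreal (\<Sum>n. (1/2)^n)"
    by (rule suminf_ennreal2) (simp_all add: summable_geometric)
  also have "\<dots> < \<infinity>"
    by simp
  finally have "AE x in lborel. (\<Sum>n. ennreal (2^n * (cmod (g (Suc n) x - g n x))\<^sup>2)) \<noteq> \<infinity>"
    by (intro nn_integral_PInf_AE) auto
  then have conv: "AE x in lborel. convergent (\<lambda>n. g n x)"
  proof eventually_elim
    case (elim x)
    have "summable (\<lambda>n. 2^n * (cmod (g (Suc n) x - g n x))\<^sup>2)"
      using elim by (intro summable_suminf_not_top) auto
    then have s: "summable (\<lambda>n. 2^n * (cmod (g (Suc n) x - g n x))\<^sup>2 + (1/2)^n)"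
      by (intro summable_add summable_geometric) auto
    have "cmod (g (Suc n) x - g n x) \<le> 2^n * (cmod (g (Suc n) x - g n x))\<^sup>2 + (1/2)^n" for n
    proof -
      define t q where "t = cmod (g (Suc n) x - g n x)" and "q = (2::real)^n"
      have q: "q > 0" and t: "t \<ge> 0" by (auto simp: q_def t_def)
      have "0 \<le> (q * t - 1)\<^sup>2 + q * t" using q t by simp
      then have "q * t \<le> q * (q * t\<^sup>2 + 1 / q)"
        using q by (simp add: power2_eq_square algebra_simps)
      then have "t \<le> q * t\<^sup>2 + 1 / q"
        using q by (simp add: mult_le_cancel_left_pos)
      then show ?thesis by (simp add: t_def q_def power_one_over)
    qed
    then have "summable (\<lambda>n. g (Suc n) x - g n x)"
      by (intro summable_comparison_test'[OF s]) auto
    then have "convergent (\<lambda>n. \<Sum>i<n. g (Suc i) x - g i x)"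
      by (simp add: summable_iff_convergent)
    then have "convergent (\<lambda>n. g n x - g 0 x)"
      by (simp only: sum_lessThan_telescope[of "\<lambda>n. g n x"])
    then show ?case
      using convergent_add[OF _ convergent_const[of "g 0 x"]] by fastforce
  qed
  define f where "f x = lim (\<lambda>n. g n x)" for x
  have fm [measurable]: "f \<in> borel_measurable lborel"
    unfolding f_def by measurable
  have close: "(\<integral>\<^sup>+x. ennreal ((cmod (f x - g n x))\<^sup>2) \<partial>lborel) \<le> ennreal ((1/4)^n)" for n
  proof -
    have "(\<integral>\<^sup>+x. ennreal ((cmod (f x - g n x))\<^sup>2) \<partial>lborel)
        = (\<integral>\<^sup>+x. liminf (\<lambda>m. ennreal ((cmod (g m x - g n x))\<^sup>2)) \<partial>lborel)"
    proof (rule nn_integral_cong_AE, use conv in eventually_elim)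
      case (elim x)
      then have "(\<lambda>m. g m x) \<longlonglongrightarrow> f x"
        by (simp add: f_def convergent_LIMSEQ_iff)
      then have "(\<lambda>m. ennreal ((cmod (g m x - g n x))\<^sup>2)) \<longlonglongrightarrow> ennreal ((cmod (f x - g n x))\<^sup>2)"
        by (intro tendsto_intros) auto
      then show ?case
        by (intro lim_imp_Liminf[symmetric]) auto
    qed
    also have "\<dots> \<le> liminf (\<lambda>m. \<integral>\<^sup>+x. ennreal ((cmod (g m x - g n x))\<^sup>2) \<partial>lborel)"
      by (rule nn_integral_liminf) measurable
    also have "\<dots> \<le> ennreal ((1/4)^n)"
      by (rule Liminf_le) (auto intro!: eventually_sequentiallyI[of n] near)
    finally show ?thesis .
  qed
  have fg: "sq_integrable (\<lambda>x. f x - g n x)" for n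
    unfolding sq_integrable_def
    by (auto intro!: integrableI_bounded le_less_trans[OF close[of n]])
  then have f: "sq_integrable f"
    using sq_integrable_add[OF fg[of 0] g(1)[of 0]] by simp
  have "norm (X (r n) - abs_L2 f) \<le> (1/2)^n" for n
  proof -
    have "ennreal ((norm (abs_L2 f - X (r n)))\<^sup>2) \<le> ennreal ((1/4)^n)"
      using close[of n] f g by (simp add: nn_integral_norm_abs_L2[OF fg] minus_L2.abs_eq)
    then have "(norm (abs_L2 f - X (r n)))\<^sup>2 \<le> ((1/2)^n)\<^sup>2"
      by (simp add: power2_eq_square flip: power_mult_distrib)
    then show ?thesis
      by (subst norm_minus_commute) (rule power2_le_imp_le, auto)
  qed
  then have "(\<lambda>n. X (r n) - abs_L2 f) \<longlonglongrightarrow> 0"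
    by (intro Lim_null_comparison[OF _ LIMSEQ_power_zero[of "1/2::real"]]) auto
  then have "(X \<circ> r) \<longlonglongrightarrow> abs_L2 f"
    by (subst LIM_zero_iff[symmetric]) (simp add: o_def)
  then show "convergent X"
    using Cauchy_converges_subseq[OF X r] unfolding convergent_def by blast
qed


section \<open>The Fourier transform and the operators\<close>

definition fourier_integral :: "(real \<Rightarrow> complex) \<Rightarrow> real \<Rightarrow> complex" where
  "fourier_integral f \<xi> =
     complex_of_real (1 / sqrt (2 * pi)) * (LINT x|lborel. f x * exp (- (\<i> * x * \<xi>)))"

text \<open>The unitary operator extending the Fourier integral from the dense subspace
  of integrable functions in \<open>L2\<close>; there is exactly one by Plancherel's theorem.
  Here and below \<open>rep_L2 f\<close> is some square-integrable representative of the class \<open>f\<close>; the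
  choice is immaterial.\<close>

definition fourier :: "L2 \<Rightarrow> L2" where
  "fourier = (THE U. unitary U \<and>
     (\<forall>f. integrable lborel (rep_L2 f) \<longrightarrow>
        (AE \<xi> in lborel. rep_L2 (U f) \<xi> = fourier_integral (rep_L2 f) \<xi>)))"

definition F_op :: "L2 operator" where
  "F_op = Operator UNIV fourier"

definition A_op :: "L2 operator" where
  "A_op = Operator {f. sq_integrable (\<lambda>x. complex_of_real (exp (x\<^sup>2 / 2)) * rep_L2 f x)}
     (\<lambda>f. abs_L2 (\<lambda>x. complex_of_real (exp (x\<^sup>2 / 2)) * rep_L2 f x))"

definition B_op :: "L2 operator" where
  "B_op = op_adjoint F_op \<circ>\<^sub>o A_op \<circ>\<^sub>o F_op"

definition T_op :: "L2 operator" where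
  "T_op = op_inverse A_op \<circ>\<^sub>o B_op"

end

theory Submission
  imports Defs "HOL-Probability.Levy" "HOL-Complex_Analysis.Conformal_Mappings"
    "HOL-Real_Asymp.Real_Asymp"
begin

text \<open>
  Let \<open>N\<close> (below: \<open>damp\<close>) be multiplication by \<open>exp (- x\<^sup>2 / 2)\<close>, a bounded injective
  self-adjoint operator. Then \<open>A\<close> is the inverse of \<open>N\<close>, defined on the range of \<open>N\<close>, so that
  the domain of \<open>T\<close> is the range of \<open>\<F>\<^sup>* N\<close> and \<open>T\<close> maps \<open>\<F>\<^sup>* N h\<close> to \<open>N \<F>\<^sup>* h\<close>.

  Everything rests on one uncertainty principle, the borderline case of the Cowling--Price
  theorem in \<open>L\<^sup>2\<close> (lemma \<open>cowling_price\<close>): a function of the form \<open>N h\<close> whose Fourier transform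
  is again of the form \<open>N k\<close> vanishes. If \<open>x\<close> is in the domain of \<open>T\<^sup>2\<close>, then \<open>T x\<close> is
  \<open>N\<close> of something, and its Fourier transform lies in the range of \<open>N\<close>; hence \<open>T x = 0\<close> and
  \<open>x = 0\<close>. If \<open>y\<close> is in the domain of \<open>T\<^sup>*\<close> and \<open>z = T\<^sup>* y\<close>, moving all operators to the
  right-hand side of the inner product gives \<open>\<F> N y = N \<F> z\<close>, hence \<open>y = 0\<close>. Paranormality is
  then a statement about the zero vector only, and an operator with dense domain whose adjoint has
  domain \<open>{0}\<close> has a dense graph, so no closed operator extends it.

  The Cowling--Price theorem is proved by complex analysis. For \<open>f = N h\<close> the Fourier transform
  extends to an entire function \<open>F\<close> with \<open>\<bar>F z\<bar> \<le> C exp ((Im z)\<^sup>2 / 2)\<close>, so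
  \<open>G z = exp (z\<^sup>2 / 2) F z\<close> satisfies \<open>\<bar>G z\<bar> \<le> C exp ((Re z)\<^sup>2 / 2)\<close>, and on the real line \<open>G\<close>
  is a multiple of \<open>k\<close>, thus square integrable. The primitive of \<open>G\<close> grows at most linearly along the
  real line, and a Phragmen--Lindelof argument in each quadrant shows that it grows at most linearly
  everywhere. By Liouville's theorem \<open>G\<close> is constant, and a square-integrable constant is \<open>0\<close>.

  The Fourier transform enters through its definition as \<^emph>\<open>the\<close> unitary operator given by the
  Fourier integral on integrable functions, so Plancherel's theorem has to be proved as well. The
  Gaussians \<open>exp (- x\<^sup>2 / 2 + c x)\<close> with complex \<open>c\<close> have explicit inner products and explicit Fourier
  transforms, which are again multiples of such Gaussians. Both families span dense subspaces, because
  the Fourier transform is injective on integrable functions (Levy's uniqueness theorem).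
  Hence there is exactly one unitary operator with the prescribed values on the Gaussians, and the
  multiplication formula for the Fourier integral identifies it on all integrable functions.
\<close>

section \<open>Hilbert spaces: orthogonality and isometries\<close>

text \<open>
  The projection theorem in the form needed here: a minimizing sequence for the distance from \<open>v\<close>
  to \<open>S\<close> is Cauchy by the parallelogram law, and the error of its limit is orthogonal to \<open>S\<close>.
\<close>
lemma closed_subspace_eq_UNIV:
  fixes S :: "'a::{real_inner, complete_space} set"
  assumes sub: "subspace S" and cl: "closed S"
    and orth: "\<And>y. (\<And>x. x \<in> S \<Longrightarrow> inner x y = 0) \<Longrightarrow> y = 0"
  shows "S = UNIV"
proof -
  have "v \<in> S" for v
  proof -
    define d where "d = (INF x\<in>S. (norm (v - x))\<^sup>2)"
    have S0: "0 \<in> S" using sub by (rule subspace_0)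
    have bdd: "bdd_below ((\<lambda>x. (norm (v - x))\<^sup>2) ` S)" by (rule bdd_belowI[of _ 0]) auto
    have d: "d \<le> (norm (v - x))\<^sup>2" if "x \<in> S" for x
      unfolding d_def by (rule cINF_lower[OF bdd that])
    have "\<exists>x\<in>S. (norm (v - x))\<^sup>2 < d + 1 / real (Suc n)" for n
      using cINF_less_iff[OF _ bdd, of "d + 1 / real (Suc n)"] S0 by (auto simp: d_def)
    then obtain X where X: "\<And>n. X n \<in> S" "\<And>n. (norm (v - X n))\<^sup>2 < d + 1 / real (Suc n)"
      by metis
    have para: "(norm (a - b))\<^sup>2 \<le> 2 * ((norm (v - a))\<^sup>2 - d) + 2 * ((norm (v - b))\<^sup>2 - d)"
      if "a \<in> S" "b \<in> S" for a b
    proof -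
      \<comment> \<open>the midpoint is again a competitor\<close>
      have "(1/2) *\<^sub>R (a + b) \<in> S" using sub that by (intro subspace_scale subspace_add)
      then have "4 * d \<le> 4 * (norm (v - (1/2) *\<^sub>R (a + b)))\<^sup>2" using d by fastforce
      also have "\<dots> = 2 * (norm (v - a))\<^sup>2 + 2 * (norm (v - b))\<^sup>2 - (norm (a - b))\<^sup>2"
        by (simp add: power2_norm_eq_inner algebra_simps inner_commute)
      finally show ?thesis by simp
    qed
    have "Cauchy X"
    proof (rule CauchyI)
      fix e :: real assume e: "0 < e"
      then obtain N where N: "4 / e\<^sup>2 < real N" using reals_Archimedean2 by blast
      have "norm (X m - X n) < e" if mn: "m \<ge> N" "n \<ge> N" for m n
      proof -
        have b: "(norm (v - X k))\<^sup>2 - d < e\<^sup>2 / 4" if "k \<ge> N" for k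
        proof -
          have "4 / e\<^sup>2 < real (Suc k)" using N that by linarith
          then have "1 / real (Suc k) < e\<^sup>2 / 4" using e by (simp add: field_simps)
          then show ?thesis using X(2)[of k] by linarith
        qed
        have "(norm (X m - X n))\<^sup>2 < e\<^sup>2"
        proof -
          have "(norm (X m - X n))\<^sup>2 \<le> 2 * ((norm (v - X m))\<^sup>2 - d) + 2 * ((norm (v - X n))\<^sup>2 - d)"
            by (rule para[OF X(1) X(1)])
          also have "\<dots> < 2 * (e\<^sup>2 / 4) + 2 * (e\<^sup>2 / 4)"
            by (intro add_strict_mono mult_strict_left_mono b mn) auto
          finally show ?thesis by simp
        qed
        then show ?thesis using e by (simp add: power2_less_imp_less)
      qed
      then show "\<exists>M. \<forall>m\<ge>M. \<forall>n\<ge>M. norm (X m - X n) < e" by blast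
    qed
    then obtain x where x: "X \<longlonglongrightarrow> x" using Cauchy_convergent_iff convergent_def by blast
    have xS: "x \<in> S" using cl X(1) x closed_sequentially by blast
    have "(\<lambda>n. (norm (v - X n))\<^sup>2) \<longlonglongrightarrow> (norm (v - x))\<^sup>2" by (intro tendsto_intros x)
    moreover have "(\<lambda>n. d + 1 / real (Suc n)) \<longlonglongrightarrow> d + 0"
      by (intro tendsto_intros LIMSEQ_Suc[OF lim_1_over_n])
    ultimately have dx: "(norm (v - x))\<^sup>2 \<le> d"
      using X(2) by (intro LIMSEQ_le) (auto intro!: exI[of _ 0] less_imp_le)
    have expand: "(norm (w - t *\<^sub>R s))\<^sup>2 = (norm w)\<^sup>2 - 2 * t * inner s w + t\<^sup>2 * (norm s)\<^sup>2"
      for w s :: 'a and t :: real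
      unfolding power2_norm_eq_inner
      by (simp add: inner_diff_left inner_diff_right inner_commute power2_eq_square algebra_simps)
    have "inner s (v - x) = 0" if s: "s \<in> S" for s
    proof (cases "s = 0")
      case False
      define t where "t = inner s (v - x) / (norm s)\<^sup>2"
      have "x + t *\<^sub>R s \<in> S" using sub s xS by (intro subspace_scale subspace_add)
      then have "(norm (v - x))\<^sup>2 \<le> (norm ((v - x) - t *\<^sub>R s))\<^sup>2" using d[of "x + t *\<^sub>R s"] dx unfolding diff_diff_eq by linarith
      also have "\<dots> = (norm (v - x))\<^sup>2 - 2 * t * inner s (v - x) + t\<^sup>2 * (norm s)\<^sup>2"
        by (rule expand)
      also have "\<dots> = (norm (v - x))\<^sup>2 - (inner s (v - x))\<^sup>2 / (norm s)\<^sup>2"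
        using False by (simp add: t_def power2_eq_square field_simps)
      finally have "(inner s (v - x))\<^sup>2 / (norm s)\<^sup>2 \<le> 0" by simp
      then show ?thesis using False by (simp add: divide_le_0_iff)
    qed simp
    then have "v - x = 0" by (rule orth)
    then show ?thesis using xS by simp
  qed
  then show ?thesis by auto
qed

lemma subspace_closure:
  fixes S :: "'a::real_normed_vector set"
  assumes S: "subspace S"
  shows "subspace (closure S)"
  unfolding subspace_def
proof (intro conjI ballI allI)
  show "0 \<in> closure S" using subspace_0[OF S] closure_subset by blast
next
  fix x y assume "x \<in> closure S" "y \<in> closure S"
  then obtain f h where "\<And>n. f n \<in> S" "f \<longlonglongrightarrow> x" "\<And>n. h n \<in> S" "h \<longlonglongrightarrow> y"
    unfolding closure_sequential by metis
  then show "x + y \<in> closure S"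
    unfolding closure_sequential using subspace_add[OF S] tendsto_add
    by (intro exI[of _ "\<lambda>n. f n + h n"]) blast
next
  fix c :: real and x assume "x \<in> closure S"
  then obtain f where "\<And>n. f n \<in> S" "f \<longlonglongrightarrow> x"
    unfolding closure_sequential by metis
  then show "c *\<^sub>R x \<in> closure S"
    unfolding closure_sequential using subspace_scale[OF S] tendsto_scaleR[OF tendsto_const]
    by (intro exI[of _ "\<lambda>n. c *\<^sub>R f n"]) blast
qed

lemma subspace_dense:
  fixes S :: "'a::{real_inner, complete_space} set"
  assumes "subspace S" and orth: "\<And>y. (\<And>x. x \<in> S \<Longrightarrow> inner x y = 0) \<Longrightarrow> y = 0"
  shows "closure S = UNIV"
proof (rule closed_subspace_eq_UNIV)
  show "y = 0" if "\<And>x. x \<in> closure S \<Longrightarrow> inner x y = 0" for y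
    using orth that closure_subset by blast
qed (use assms in \<open>auto intro: subspace_closure\<close>)

text \<open>
  In a Hilbert space this is equivalent to density of the linear span.
\<close>
definition total_family :: "('i \<Rightarrow> 'a::real_inner) \<Rightarrow> bool" where
  "total_family g \<longleftrightarrow> (\<forall>y. (\<forall>i. inner (g i) y = 0) \<longrightarrow> y = 0)"

lemma bounded_linear_eq_on_total:
  fixes g :: "'i \<Rightarrow> 'a::{real_inner, complete_space}"
  assumes f: "bounded_linear f" and f': "bounded_linear f'" and "total_family g"
    and eq: "\<And>i. f (g i) = f' (g i)"
  shows "f x = f' x"
proof -
  have bl: "bounded_linear (\<lambda>x. f x - f' x)" using f f' by (rule bounded_linear_sub)
  have "{x. f x - f' x = 0} = UNIV"
  proof (rule closed_subspace_eq_UNIV)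
    show "subspace {x. f x - f' x = 0}"
      using linear_subspace_kernel[OF bounded_linear.linear[OF bl]] .
    show "closed {x. f x - f' x = 0}"
      by (intro closed_Collect_eq continuous_on_const linear_continuous_on bl)
    show "y = 0" if "\<And>x. x \<in> {x. f x - f' x = 0} \<Longrightarrow> inner x y = 0" for y
      using \<open>total_family g\<close> that eq by (auto simp: total_family_def)
  qed
  then show ?thesis by auto
qed

text \<open>
  The closure \<open>G\<close> of the span of the pairs \<open>(g i, k i)\<close> in the product space is the graph of the
  isometry. Equality of inner products passes from the generators to \<open>G\<close>, so both projections of \<open>G\<close>
  are multiples of isometries; their images are therefore complete, and by totality they are everything.
  Working with the graph avoids showing that a linear map on the span is well defined.
\<close>
lemma isometry_extension:
  fixes g k :: "'i \<Rightarrow> 'a::{real_inner, complete_space}"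
  assumes inner_eq: "\<And>i j. inner (g i) (g j) = inner (k i) (k j)"
    and g: "total_family g" and k: "total_family k"
  obtains U where "bounded_linear U" "\<And>x y. inner (U x) (U y) = inner x y" "surj U" "\<And>i. U (g i) = k i"
proof -
  define B where "B = range (\<lambda>i. (g i, k i))"
  define G where "G = closure (span B)"
  have BG: "(g i, k i) \<in> G" for i
    unfolding G_def B_def by (meson closure_subset rangeI span_base subsetD)
  have subG: "subspace G" unfolding G_def by (intro subspace_closure subspace_span)
  have clG: "closed G" by (simp add: G_def)
  have hull: "G \<subseteq> T" if "subspace T" "closed T" "B \<subseteq> T" for T
    unfolding G_def using that by (intro closure_minimal span_minimal)
  define Q where "Q p q = inner (fst p) (fst q) - inner (snd p) (snd q)" for p q :: "'a \<times> 'a"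
  have Qsub: "subspace {p. Q p q = 0}" for q
    by (auto simp: subspace_def Q_def inner_add_left)
  have Qcl: "closed {p. Q p q = 0}" for q
    unfolding Q_def by (intro closed_Collect_eq continuous_intros)
  have Qcom: "Q p q = Q q p" for p q by (simp add: Q_def inner_commute)
  have Qg: "Q (g i, k i) (g j, k j) = 0" for i j by (simp add: Q_def inner_eq)
  have QgG: "Q (g j, k j) p = 0" if "p \<in> G" for p j
    using hull[OF Qsub Qcl, of "(g j, k j)"] Qg that by (auto simp: B_def Qcom)
  have "Q p q = 0" if "p \<in> G" "q \<in> G" for p q
  proof -
    have "B \<subseteq> {p. Q p q = 0}" using QgG[OF that(2)] by (auto simp: B_def)
    then show ?thesis using hull[OF Qsub Qcl] that(1) by blast
  qed
  then have iso: "inner (fst p) (fst q) = inner (snd p) (snd q)" if "p \<in> G" "q \<in> G" for p q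
    using that by (simp add: Q_def)
  have n: "norm (fst p) = norm (snd p)" if "p \<in> G" for p
    using iso[OF that that] by (simp add: norm_eq_sqrt_inner)
  have np: "norm p = sqrt 2 * norm (fst p)" "norm p = sqrt 2 * norm (snd p)" if "p \<in> G" for p
    using n[OF that] by (auto simp: norm_prod_def real_sqrt_mult simp flip: mult_2)
  have compl: "complete G" using clG by (simp add: complete_eq_closed)
  have onto: "\<pi> ` G = UNIV" if \<pi>: "bounded_linear \<pi>" "\<And>p. p \<in> G \<Longrightarrow> norm p = sqrt 2 * norm (\<pi> p)"
      and b: "total_family b" "\<And>i. b i \<in> \<pi> ` G" for \<pi> :: "'a \<times> 'a \<Rightarrow> 'a" and b :: "'i \<Rightarrow> 'a"
  proof (rule closed_subspace_eq_UNIV)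
    show "subspace (\<pi> ` G)"
      using subG \<pi>(1) bounded_linear.linear linear_subspace_image by blast
    have "complete (\<pi> ` G)"
      by (rule complete_isometric_image[of "1 / sqrt 2", OF _ subG \<pi>(1) _ compl]) (use \<pi>(2) in auto)
    then show "closed (\<pi> ` G)" by (rule complete_imp_closed)
    show "y = 0" if "\<And>x. x \<in> \<pi> ` G \<Longrightarrow> inner x y = 0" for y
      using b that by (auto simp: total_family_def)
  qed
  have "g i \<in> fst ` G" "k i \<in> snd ` G" for i
    using image_eqI[OF _ BG[of i], of "g i" fst] image_eqI[OF _ BG[of i], of "k i" snd] by simp_all
  note gk = this
  have fstG: "fst ` G = UNIV"
    by (rule onto[where \<pi> = fst and b = g]) (use np(1) g gk in \<open>auto intro: bounded_linear_fst\<close>)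
  have sndG: "snd ` G = UNIV"
    by (rule onto[where \<pi> = snd and b = k]) (use np(2) k gk in \<open>auto intro: bounded_linear_snd\<close>)
  have uniq: "y = z" if "(x, y) \<in> G" "(x, z) \<in> G" for x y z
  proof -
    have "(x, y) - (x, z) \<in> G" using subG that by (rule subspace_diff)
    from n[OF this] show ?thesis by simp
  qed
  have "\<exists>y. (x, y) \<in> G" for x
  proof -
    have "x \<in> fst ` G" by (simp add: fstG)
    then show ?thesis by force
  qed
  then obtain U where U: "\<And>x. (x, U x) \<in> G" by metis
  have "U (x + y) = U x + U y" for x y
    using uniq[OF U subspace_add[OF subG U U, of x y, simplified]] .
  moreover have "U (c *\<^sub>R x) = c *\<^sub>R U x" for c x
    using uniq[OF U subspace_scale[OF subG U, of c x, simplified]] .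
  moreover have nU: "norm (U x) = norm x" for x using n[OF U[of x]] by simp
  ultimately have "bounded_linear U" by (intro bounded_linear_intro[where K = 1]) auto
  moreover have "inner (U x) (U y) = inner x y" for x y using iso[OF U U, of x y] by simp
  moreover have "y \<in> range U" for y
  proof -
    obtain x where "(x, y) \<in> G"
    proof -
      have "y \<in> snd ` G" by (simp add: sndG)
      then show ?thesis using that by force
    qed
    then have "y = U x" by (rule uniq[OF _ U])
    then show ?thesis by simp
  qed
  moreover have "U (g i) = k i" for i by (rule uniq[OF U BG])
  ultimately show ?thesis using that by blast
qed

section \<open>Gaussian integrals and injectivity of the Fourier transform\<close>

text \<open>
  For imaginary \<open>c\<close> this is the characteristic function of the normal distribution; a real
  translation takes care of the real part of \<open>c\<close>.
\<close>
lemma has_bochner_integral_gaussian_exp: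
  fixes c :: complex
  shows "has_bochner_integral lborel (\<lambda>x::real. exp (- (complex_of_real x)\<^sup>2 / 2 + c * complex_of_real x))
    (complex_of_real (sqrt (2 * pi)) * exp (c\<^sup>2 / 2))"
proof -
  have imag: "has_bochner_integral lborel (\<lambda>x::real. exp (- (complex_of_real x)\<^sup>2 / 2) * iexp (t * x))
      (complex_of_real (sqrt (2 * pi)) * exp (- (complex_of_real t)\<^sup>2 / 2))" for t :: real
  proof -
    have e0: "exp (- (complex_of_real t)\<^sup>2 / 2) = complex_of_real (exp (- t\<^sup>2 / 2))"
      by (simp flip: exp_of_real)
    interpret real_distribution std_normal_distribution by (rule real_dist_normal_dist)
    have "integrable std_normal_distribution (\<lambda>x. iexp (t * x))" by (rule integrable_iexp) auto
    then have i: "integrable lborel (\<lambda>x. std_normal_density x *\<^sub>R iexp (t * x))"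
      by (subst (asm) integrable_density) auto
    have "(LINT x|lborel. std_normal_density x *\<^sub>R iexp (t * x)) = char std_normal_distribution t"
      unfolding char_def by (subst integral_density) auto
    then have "has_bochner_integral lborel (\<lambda>x. std_normal_density x *\<^sub>R iexp (t * x)) (exp (- (complex_of_real t)\<^sup>2 / 2))"
      using i e0 by (simp add: has_bochner_integral_iff char_std_normal_distribution)
    from has_bochner_integral_mult_right[OF this, of "complex_of_real (sqrt (2 * pi))"]
    have "has_bochner_integral lborel (\<lambda>x. complex_of_real (sqrt (2 * pi)) * (std_normal_density x *\<^sub>R iexp (t * x)))
      (complex_of_real (sqrt (2 * pi)) * exp (- (complex_of_real t)\<^sup>2 / 2))" by simp
    moreover have "complex_of_real (sqrt (2 * pi)) * (std_normal_density x *\<^sub>R iexp (t * x))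
        = exp (- (complex_of_real x)\<^sup>2 / 2) * iexp (t * x)" for x
      by (simp add: normal_density_def scaleR_conv_of_real flip: exp_of_real)
    ultimately show ?thesis by (simp only:)
  qed
  define a b where "a = Re c" and "b = Im c"
  have c: "c = a + \<i> * b" by (simp add: a_def b_def complex_eq)
  have e1: "- (complex_of_real (a + x))\<^sup>2 / 2 + c * complex_of_real (a + x) =
      (- (complex_of_real x)\<^sup>2 / 2 + \<i> * (b * x)) + (a\<^sup>2 / 2 + \<i> * a * b)" for x :: real
    by (simp add: c power2_eq_square field_simps)
  have e2: "c\<^sup>2 / 2 = - (complex_of_real b)\<^sup>2 / 2 + (a\<^sup>2 / 2 + \<i> * a * b)"
    by (simp add: c power2_eq_square field_simps)
  have "has_bochner_integral lborel (\<lambda>x::real. exp (- (complex_of_real (a + x))\<^sup>2 / 2 + c * complex_of_real (a + x)))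
      (complex_of_real (sqrt (2 * pi)) * exp (c\<^sup>2 / 2))"
    using has_bochner_integral_mult_left[OF imag[of b], of "exp (a\<^sup>2 / 2 + \<i> * a * b)"]
    unfolding e1 e2 exp_add mult.assoc .
  then show ?thesis
    using lborel_has_bochner_integral_real_affine_iff[of 1 "\<lambda>x. exp (- (complex_of_real x)\<^sup>2 / 2 + c * complex_of_real x)"
        "complex_of_real (sqrt (2 * pi)) * exp (c\<^sup>2 / 2)" a]
    by simp
qed

lemma has_bochner_integral_gaussian_square_exp:
  fixes c :: complex
  shows "has_bochner_integral lborel (\<lambda>x::real. exp (- (complex_of_real x)\<^sup>2 + c * complex_of_real x))
    (complex_of_real (sqrt pi) * exp (c\<^sup>2 / 4))"
proof -
  let ?s = "1 / sqrt 2 :: real"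
  have s2: "(complex_of_real ?s)\<^sup>2 = 1 / 2" by (simp add: power_divide flip: of_real_power)
  have e: "- (complex_of_real x)\<^sup>2 / 2 + c * ?s * complex_of_real x
      = - (complex_of_real (0 + ?s * x))\<^sup>2 + c * complex_of_real (0 + ?s * x)" for x :: real
    using s2 by (simp add: power_mult_distrib power_divide flip: of_real_power)
  have e2: "(c * ?s)\<^sup>2 / 2 = c\<^sup>2 / 4" unfolding power_mult_distrib s2 by simp
  have r: "complex_of_real (sqrt (2 * pi)) * w = (complex_of_real (sqrt pi) * w) /\<^sub>R \<bar>?s\<bar>" for w
    by (simp add: scaleR_conv_of_real real_sqrt_mult)
  show ?thesis
    using has_bochner_integral_gaussian_exp[of "c * ?s"]
      lborel_has_bochner_integral_real_affine_iff[of ?s "\<lambda>x. exp (- (complex_of_real x)\<^sup>2 + c * complex_of_real x)"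
        "complex_of_real (sqrt pi) * exp (c\<^sup>2 / 4)" 0]
    unfolding e e2 r by simp
qed

text \<open>
  The positive and the negative part of \<open>h\<close> have the same mass (take \<open>t = 0\<close>); after normalization
  they are densities of two probability measures with the same characteristic function.
\<close>
lemma fourier_injective_real:
  fixes h :: "real \<Rightarrow> real"
  assumes h: "integrable lborel h" and zero: "\<And>t. (LINT x|lborel. h x * iexp (t * x)) = 0"
  shows "AE x in lborel. h x = 0"
proof -
  define p n where "p x = max 0 (h x)" and "n x = max 0 (- h x)" for x
  have pn: "h x = p x - n x" for x by (simp add: p_def n_def max_def)
  have int: "integrable lborel p" "integrable lborel n"
    unfolding p_def n_def using h by auto
  then have [measurable]: "p \<in> borel_measurable borel" "n \<in> borel_measurable borel" by auto
  have nn: "0 \<le> p x" "0 \<le> n x" for x by (auto simp: p_def n_def)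
  have int_iexp: "integrable lborel (\<lambda>x. q x * iexp (t * x))" if "integrable lborel q" for q t
    using that borel_measurable_integrable[OF that]
    by (intro Bochner_Integration.integrable_bound[OF that]) (auto simp: norm_mult)
  have eq: "(LINT x|lborel. p x * iexp (t * x)) = (LINT x|lborel. n x * iexp (t * x))" for t
    using zero[of t] int_iexp[of p t] int_iexp[of n t] int
    by (simp add: pn of_real_diff left_diff_distrib)
  define m where "m = integral\<^sup>L lborel p"
  have "complex_of_real m = complex_of_real (integral\<^sup>L lborel n)"
    using eq[of 0] by (simp add: m_def)
  then have m: "integral\<^sup>L lborel n = m" by simp
  have "0 \<le> m" using nn by (simp add: m_def)
  show ?thesis
  proof (cases "m = 0")
    case True
    then have "AE x in lborel. p x = 0" "AE x in lborel. n x = 0"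
      using integral_nonneg_eq_0_iff_AE[OF int(1)] integral_nonneg_eq_0_iff_AE[OF int(2)] nn m m_def by auto
    then show ?thesis by eventually_elim (simp add: pn)
  next
    case False
    with \<open>0 \<le> m\<close> have m0: "0 < m" by simp
    have dist: "real_distribution (density lborel (\<lambda>x. q x / m))"
      if q: "integrable lborel q" "\<And>x. 0 \<le> q x" "integral\<^sup>L lborel q = m" for q
    proof -
      have "(\<integral>\<^sup>+x. ennreal (q x / m) \<partial>lborel) = ennreal (LINT x|lborel. q x / m)"
        using q m0 by (intro nn_integral_eq_integral) auto
      also have "\<dots> = 1" using q m0 by simp
      finally have "emeasure (density lborel (\<lambda>x. q x / m)) UNIV = 1"
        using borel_measurable_integrable[OF q(1)] by (subst emeasure_density) auto
      then show ?thesis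
        unfolding real_distribution_def real_distribution_axioms_def
        by (auto intro!: prob_spaceI)
    qed
    have ch: "char (density lborel (\<lambda>x. q x / m)) t = (LINT x|lborel. q x * iexp (t * x)) / m"
      if q: "q \<in> borel_measurable lborel" "\<And>x. 0 \<le> q x" for q t
    proof -
      have "char (density lborel (\<lambda>x. q x / m)) t = (LINT x|lborel. (q x / m) *\<^sub>R iexp (t * x))"
        unfolding char_def using q m0 by (subst integral_density) auto
      also have "\<dots> = (LINT x|lborel. q x * iexp (t * x) / m)"
        by (simp add: scaleR_conv_of_real)
      finally show ?thesis by simp
    qed
    have "char (density lborel (\<lambda>x. p x / m)) t = char (density lborel (\<lambda>x. n x / m)) t" for t
      using ch[of p t] ch[of n t] nn eq[of t] by simp
    then have "density lborel (\<lambda>x. p x / m) = density lborel (\<lambda>x. n x / m)"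
      using int nn m by (intro Levy_uniqueness dist ext) (auto simp: m_def)
    then have "AE x in lborel. ennreal (p x / m) = ennreal (n x / m)"
      by (subst (asm) sigma_finite_measure.density_unique_iff[OF lborel.sigma_finite_measure_axioms]) auto
    then show ?thesis
    proof eventually_elim
      case (elim x)
      then have "p x / m = n x / m" using nn m0 by (subst (asm) ennreal_inj) auto
      then show ?case using m0 by (simp add: pn)
    qed
  qed
qed

text \<open>
  The conjugate of \<open>h\<close> also has vanishing Fourier transform, hence so do its real and imaginary part.
\<close>
lemma fourier_injective:
  fixes h :: "real \<Rightarrow> complex"
  assumes h: "integrable lborel h" and zero: "\<And>t. (LINT x|lborel. h x * iexp (t * x)) = 0"
  shows "AE x in lborel. h x = 0"
proof -
  have hm [measurable]: "h \<in> borel_measurable borel" using h by auto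
  have int: "integrable lborel (\<lambda>x. h x * iexp (t * x))" for t
    by (rule Bochner_Integration.integrable_bound[OF h]) (auto simp: norm_mult)
  have "(LINT x|lborel. cnj (h x) * iexp (t * x)) = cnj (LINT x|lborel. h x * iexp (- t * x))" for t
    by (simp flip: Bochner_Integration.integral_cnj add: exp_cnj)
  then have zero': "(LINT x|lborel. cnj (h x) * iexp (t * x)) = 0" for t
    using zero[of "- t"] by simp
  have int': "integrable lborel (\<lambda>x. cnj (h x) * iexp (t * x))" for t
    using integrable_cnj[OF int[of "- t"]] by (simp add: exp_cnj)
  have "AE x in lborel. Re (h x) = 0"
  proof (rule fourier_injective_real)
    fix t
    have "(LINT x|lborel. complex_of_real (Re (h x)) * iexp (t * x))
        = (LINT x|lborel. (h x * iexp (t * x) + cnj (h x) * iexp (t * x)) / 2)"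
      by (intro Bochner_Integration.integral_cong refl)
        (simp add: complex_add_cnj flip: distrib_right)
    then show "(LINT x|lborel. complex_of_real (Re (h x)) * iexp (t * x)) = 0"
      using int int' zero zero' by simp
  qed (use h in simp)
  moreover have "AE x in lborel. Im (h x) = 0"
  proof (rule fourier_injective_real)
    fix t
    have "(LINT x|lborel. complex_of_real (Im (h x)) * iexp (t * x))
        = (LINT x|lborel. (h x * iexp (t * x) - cnj (h x) * iexp (t * x)) / (2 * \<i>))"
    proof (intro Bochner_Integration.integral_cong refl)
      fix x
      have "complex_of_real (Im (h x)) = (h x - cnj (h x)) / (2 * \<i>)" by (simp add: complex_eq_iff)
      then show "complex_of_real (Im (h x)) * iexp (t * x)
          = (h x * iexp (t * x) - cnj (h x) * iexp (t * x)) / (2 * \<i>)"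
        by (simp only: left_diff_distrib times_divide_eq_left)
    qed
    then show "(LINT x|lborel. complex_of_real (Im (h x)) * iexp (t * x)) = 0"
      using int int' zero zero' by simp
  qed (use h in simp)
  ultimately show ?thesis by eventually_elim (simp add: complex_eq_iff)
qed

section \<open>Square-integrable functions\<close>

lemma sq_integrable_rep_L2: "sq_integrable (rep_L2 F)"
  and abs_rep_L2 [simp]: "abs_L2 (rep_L2 F) = F"
  using Quotient_L2 unfolding Quotient_def by metis+

lemma abs_L2_eq_iff:
  "sq_integrable f \<Longrightarrow> sq_integrable g \<Longrightarrow> abs_L2 f = abs_L2 g \<longleftrightarrow> (AE x in lborel. f x = g x)"
  using Quotient3_rel[OF Quotient3_L2, of f g] by auto

lemma rep_abs_L2: "sq_integrable f \<Longrightarrow> AE x in lborel. rep_L2 (abs_L2 f) x = f x"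
  by (subst abs_L2_eq_iff[symmetric]) (auto simp: sq_integrable_rep_L2)

lemma L2_eq_iff: "F = G \<longleftrightarrow> (AE x in lborel. rep_L2 F x = rep_L2 G x)"
  using abs_L2_eq_iff[OF sq_integrable_rep_L2 sq_integrable_rep_L2, of F G] by simp

lemma rep_L2_measurable [measurable]: "rep_L2 F \<in> borel_measurable lborel"
  using sq_integrable_rep_L2 by (simp add: sq_integrable_def)

lemma cinner_abs_L2:
  "sq_integrable f \<Longrightarrow> sq_integrable g \<Longrightarrow> cinner (abs_L2 f) (abs_L2 g) = (LINT x|lborel. f x * cnj (g x))"
  by (simp add: cinner_L2.abs_eq)

lemma inner_L2_eq_Re: "inner F G = Re (cinner F (G :: L2))"
  by transfer simp

lemma cinner_scaleC_right: "cinner x (c *\<^sub>C y) = cnj c * cinner x (y :: 'a::complex_inner_space)"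
  by (metis cinner_commute cinner_scaleC_left complex_cnj_mult)

lemma cinner_zero_left [simp]: "cinner 0 (x :: 'a::complex_inner_space) = 0"
  using cinner_add_left[of 0 0 x] by simp

lemma cinner_zero_right [simp]: "cinner (x :: 'a::complex_inner_space) 0 = 0"
  using cinner_commute[of x 0] by simp

lemma cinner_diff_left: "cinner (x - y) (z :: 'a::complex_inner_space) = cinner x z - cinner y z"
  using cinner_add_left[of "x - y" y z] by simp

lemma scaleC_one: "1 *\<^sub>C (x :: 'a::complex_inner_space) = x"
  using scaleR_scaleC[of 1 x] by simp

lemma scaleC_zero_right: "c *\<^sub>C (0 :: 'a::complex_inner_space) = 0"
  using scaleC_add_right[of c 0 0] by simp

lemma norm_scaleC: "norm (c *\<^sub>C (x :: 'a::complex_inner_space)) = cmod c * norm x"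
proof -
  have "complex_of_real ((norm (c *\<^sub>C x))\<^sup>2) = cinner (c *\<^sub>C x) (c *\<^sub>C x)" by (simp add: cinner_self)
  also have "\<dots> = c * cnj c * cinner x x"
    by (simp add: cinner_scaleC_left cinner_scaleC_right)
  also have "\<dots> = complex_of_real ((cmod c * norm x)\<^sup>2)"
    by (simp add: cinner_self power_mult_distrib flip: complex_norm_square)
  finally have "(norm (c *\<^sub>C x))\<^sup>2 = (cmod c * norm x)\<^sup>2" using of_real_eq_iff by blast
  then show ?thesis by (simp add: power2_eq_iff_nonneg)
qed

lemma cinner_eq_inner: "cinner F G = Complex (inner F G) (inner F (\<i> *\<^sub>C (G::L2)))"
  by (simp add: inner_L2_eq_Re cinner_scaleC_right complex_eq_iff)

lemma bounded_linear_scaleC: "bounded_linear (\<lambda>F::L2. c *\<^sub>C F)"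
  by (rule bounded_linear_intro[where K = "cmod c"])
    (auto simp: scaleC_add_right norm_scaleC scaleR_scaleC scaleC_scaleC mult.commute)

text \<open>
  The real inner product determines the complex one, since a factor \<open>- \<i>\<close> turns the imaginary part
  into the real part. This transfers the results on real Hilbert spaces to \<open>L2\<close>.
\<close>
lemma cinner_eqI:
  fixes F G F' G' :: L2
  assumes "\<And>a. inner (a *\<^sub>C F) G = inner (a *\<^sub>C F') G'"
  shows "cinner F G = cinner F' G'"
  using assms[of 1] assms[of "- \<i>"]
  unfolding inner_L2_eq_Re cinner_scaleC_left by (simp add: complex_eq_iff)

lemma cinner_zero_if_inner_scaleC_zero:
  assumes "\<And>a. inner (a *\<^sub>C F) (G::L2) = 0"
  shows "cinner F G = 0"
  using cinner_eqI[of F G 0 G] assms by (simp add: scaleC_zero_right)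

section \<open>Plancherel's theorem\<close>

definition gauss_fun :: "complex \<Rightarrow> real \<Rightarrow> complex" where
  "gauss_fun c x = exp (- (complex_of_real x)\<^sup>2 / 2 + c * complex_of_real x)"

definition gauss :: "complex \<Rightarrow> L2" where
  "gauss c = abs_L2 (gauss_fun c)"

lemma gauss_fun_measurable [measurable]: "gauss_fun c \<in> borel_measurable borel"
  using has_bochner_integral_gaussian_exp[of c]
  by (auto simp: gauss_fun_def[abs_def] has_bochner_integral_iff)

lemma integrable_gauss_fun: "integrable lborel (gauss_fun c)"
  using has_bochner_integral_gaussian_exp[of c]
  by (simp add: gauss_fun_def[abs_def] has_bochner_integral_iff)

lemma gauss_fun_mult_cnj:
  "gauss_fun c x * cnj (gauss_fun d x) = exp (- (complex_of_real x)\<^sup>2 + (c + cnj d) * complex_of_real x)"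
  by (simp add: gauss_fun_def exp_cnj algebra_simps flip: exp_add)

lemma sq_integrable_gauss_fun: "sq_integrable (gauss_fun c)"
proof -
  have "integrable lborel (\<lambda>x. gauss_fun c x * cnj (gauss_fun c x))"
    using has_bochner_integral_gaussian_square_exp[of "c + cnj c"]
    by (simp add: gauss_fun_mult_cnj has_bochner_integral_iff)
  then have "integrable lborel (\<lambda>x. norm (gauss_fun c x * cnj (gauss_fun c x)))"
    by (rule integrable_norm)
  then show ?thesis
    unfolding sq_integrable_def by (simp add: norm_mult power2_eq_square)
qed

lemma cinner_gauss: "cinner (gauss c) (gauss d) = complex_of_real (sqrt pi) * exp ((c + cnj d)\<^sup>2 / 4)"
  using has_bochner_integral_gaussian_square_exp[of "c + cnj d"]
  by (simp add: gauss_def cinner_abs_L2 sq_integrable_gauss_fun gauss_fun_mult_cnj has_bochner_integral_iff)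

lemma gauss_fun_imaginary: "gauss_fun (\<i> * complex_of_real t) x = gauss_fun 0 x * iexp (t * x)"
  by (simp add: gauss_fun_def mult.assoc flip: exp_add)

text \<open>
  The inner products of \<open>F\<close> with the modulated Gaussians are the values of the Fourier transform of the
  integrable function \<open>gauss_fun 0 * cnj F\<close>.
\<close>
lemma gauss_total:
  assumes "\<And>t::real. cinner (gauss (\<i> * t)) F = 0"
  shows "F = 0"
proof -
  let ?h = "\<lambda>x. gauss_fun 0 x * cnj (rep_L2 F x)"
  have "AE x in lborel. ?h x = 0"
  proof (rule fourier_injective)
    show "integrable lborel ?h"
      by (rule integrable_mult_cnj[OF sq_integrable_gauss_fun sq_integrable_rep_L2])
    fix t
    have "(LINT x|lborel. ?h x * iexp (t * x)) = (LINT x|lborel. gauss_fun (\<i> * t) x * cnj (rep_L2 F x))"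
      by (intro Bochner_Integration.integral_cong refl) (simp add: gauss_fun_imaginary mult_ac)
    also have "\<dots> = cinner (gauss (\<i> * t)) F"
      using cinner_abs_L2[OF sq_integrable_gauss_fun sq_integrable_rep_L2, of "\<i> * t" F]
      by (simp add: gauss_def)
    finally show "(LINT x|lborel. ?h x * iexp (t * x)) = 0" using assms by simp
  qed
  then have "AE x in lborel. rep_L2 F x = 0"
    by eventually_elim (simp add: gauss_fun_def)
  then have "abs_L2 (rep_L2 F) = abs_L2 (\<lambda>x. 0)"
    by (subst abs_L2_eq_iff) (auto simp: sq_integrable_rep_L2 sq_integrable_zero)
  then show ?thesis by (simp add: zero_L2_def)
qed

text \<open>
  The Fourier transform of \<open>gauss c\<close>, see \<open>fourier_integral_gauss_fun\<close>.
\<close>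
definition gauss_transform :: "complex \<Rightarrow> L2" where
  "gauss_transform c = exp (c\<^sup>2 / 2) *\<^sub>C gauss (- \<i> * c)"

lemma cinner_gauss_transform:
  "cinner (gauss_transform c) (gauss_transform d) = cinner (gauss c) (gauss d)"
proof -
  have "c\<^sup>2 / 2 + ((cnj d)\<^sup>2 / 2 + (- \<i> * c + cnj (- \<i> * d))\<^sup>2 / 4) = (c + cnj d)\<^sup>2 / 4"
    by (simp add: power2_eq_square field_simps)
  then have "exp (c\<^sup>2 / 2) * (exp ((cnj d)\<^sup>2 / 2) * exp ((- \<i> * c + cnj (- \<i> * d))\<^sup>2 / 4)) = exp ((c + cnj d)\<^sup>2 / 4)"
    by (simp only: exp_add[symmetric])
  then show ?thesis
    by (simp add: gauss_transform_def cinner_scaleC_left cinner_scaleC_right cinner_gauss exp_cnj mult_ac)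
qed

lemma fourier_integral_gauss_fun:
  "fourier_integral (gauss_fun c) \<xi> = exp (c\<^sup>2 / 2) * gauss_fun (- \<i> * c) \<xi>"
proof -
  have "(LINT x|lborel. gauss_fun c x * exp (- (\<i> * complex_of_real x * complex_of_real \<xi>)))
      = (LINT x|lborel. exp (- (complex_of_real x)\<^sup>2 / 2 + (c - \<i> * \<xi>) * complex_of_real x))"
    by (intro Bochner_Integration.integral_cong refl)
      (simp add: gauss_fun_def algebra_simps flip: exp_add)
  also have "\<dots> = complex_of_real (sqrt (2 * pi)) * exp ((c - \<i> * \<xi>)\<^sup>2 / 2)"
    using has_bochner_integral_gaussian_exp by (rule has_bochner_integral_integral_eq)
  also have "(c - \<i> * \<xi>)\<^sup>2 / 2 = c\<^sup>2 / 2 + (- (complex_of_real \<xi>)\<^sup>2 / 2 + - \<i> * c * \<xi>)"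
    by (simp add: power2_eq_square field_simps)
  finally show ?thesis
    unfolding fourier_integral_def by (simp add: gauss_fun_def exp_add)
qed

lemma total_gauss_scaled: "total_family (\<lambda>(a, c). a *\<^sub>C gauss c)"
  unfolding total_family_def
  by (auto intro!: gauss_total cinner_zero_if_inner_scaleC_zero)

text \<open>
  The parameters \<open>c = - t\<close> yield multiples of all the modulated Gaussians.
\<close>
lemma total_gauss_transform: "total_family (\<lambda>(a, c). a *\<^sub>C gauss_transform c)"
  unfolding total_family_def
proof (intro allI impI)
  fix F assume F: "\<forall>i. inner (case i of (a, c) \<Rightarrow> a *\<^sub>C gauss_transform c) F = 0"
  have "inner (a *\<^sub>C gauss (\<i> * t)) F = 0" for a and t :: real
    using F[rule_format, of "(a / exp ((- complex_of_real t)\<^sup>2 / 2), - complex_of_real t)"]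
    by (simp add: gauss_transform_def scaleC_scaleC)
  then show "F = 0"
    by (intro gauss_total cinner_zero_if_inner_scaleC_zero)
qed

lemma unitary_bounded_linear:
  assumes "unitary (U :: L2 \<Rightarrow> L2)"
  shows "bounded_linear U"
proof (rule bounded_linear_intro[where K = 1])
  show "U (x + y) = U x + U y" for x y using assms by (simp add: unitary_def)
  show "U (r *\<^sub>R x) = r *\<^sub>R U x" for r x using assms by (simp add: unitary_def scaleR_scaleC)
  have "complex_of_real ((norm (U x))\<^sup>2) = complex_of_real ((norm x)\<^sup>2)" for x
    using assms by (metis cinner_self unitary_def)
  then show "norm (U x) \<le> norm x * 1" for x
    by (simp add: power2_eq_iff_nonneg del: of_real_power)
qed

text \<open>
  The scaled families make the isometry obtained over the reals complex linear.
\<close>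
lemma unitary_gauss_transform:
  obtains U where "unitary U" "\<And>c. U (gauss c) = gauss_transform c"
proof -
  obtain U where U: "bounded_linear U" "\<And>x y. inner (U x) (U y) = inner x y" "surj U"
    and Ug: "\<And>i. U ((\<lambda>(a, c). a *\<^sub>C gauss c) i) = (\<lambda>(a, c). a *\<^sub>C gauss_transform c) i"
  proof (rule isometry_extension[OF _ total_gauss_scaled total_gauss_transform])
    show "inner ((\<lambda>(a, c). a *\<^sub>C gauss c) i) ((\<lambda>(a, c). a *\<^sub>C gauss c) j) =
        inner ((\<lambda>(a, c). a *\<^sub>C gauss_transform c) i) ((\<lambda>(a, c). a *\<^sub>C gauss_transform c) j)" for i j
      by (simp add: inner_L2_eq_Re cinner_scaleC_left cinner_scaleC_right cinner_gauss_transform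
          split: prod.split)
  qed blast
  have Ug': "U (a *\<^sub>C gauss c) = a *\<^sub>C gauss_transform c" for a c
    using Ug[of "(a, c)"] by simp
  have scale: "U (c *\<^sub>C x) = c *\<^sub>C U x" for c x
    by (rule bounded_linear_eq_on_total[OF _ _ total_gauss_scaled,
          where f = "\<lambda>x. U (c *\<^sub>C x)" and f' = "\<lambda>x. c *\<^sub>C U x"])
      (auto intro: bounded_linear_compose[OF U(1) bounded_linear_scaleC]
        bounded_linear_compose[OF bounded_linear_scaleC U(1)] simp: scaleC_scaleC Ug')
  have "unitary U"
    unfolding unitary_def
  proof (intro conjI allI)
    show "U (x + y) = U x + U y" for x y by (rule linear_add[OF bounded_linear.linear[OF U(1)]])
    show "cinner (U x) (U y) = cinner x y" for x y
      by (simp add: cinner_eq_inner U(2) flip: scale)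
  qed (use scale U in auto)
  moreover have "U (gauss c) = gauss_transform c" for c
    using Ug'[of 1 c] by (simp add: scaleC_one)
  ultimately show ?thesis using that by blast
qed

lemma fourier_integral_bounded:
  assumes "integrable lborel r"
  shows "cmod (fourier_integral r \<xi>) \<le> (LINT x|lborel. cmod (r x))"
proof -
  have "cmod (LINT x|lborel. r x * exp (- (\<i> * complex_of_real x * complex_of_real \<xi>)))
      \<le> (LINT x|lborel. cmod (r x * exp (- (\<i> * complex_of_real x * complex_of_real \<xi>))))"
    by (rule integral_norm_bound)
  also have "\<dots> = (LINT x|lborel. cmod (r x))" by (simp add: norm_mult)
  also have "\<dots> \<le> sqrt (2 * pi) * (LINT x|lborel. cmod (r x))"
  proof -
    have "1 \<le> sqrt (2 * pi)" using pi_ge_two by simp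
    then show ?thesis using mult_right_mono[of 1 "sqrt (2 * pi)" "LINT x|lborel. cmod (r x)"] by simp
  qed
  finally show ?thesis
    by (simp add: fourier_integral_def norm_mult norm_divide divide_le_eq mult.commute)
qed

lemma fourier_integral_measurable [measurable]:
  assumes [measurable]: "r \<in> borel_measurable borel"
  shows "fourier_integral r \<in> borel_measurable borel"
  unfolding fourier_integral_def[abs_def] by measurable

lemma fourier_integral_multiplication:
  assumes r: "integrable lborel r" and w: "integrable lborel w"
  shows "(LINT \<xi>|lborel. fourier_integral r \<xi> * w \<xi>) = (LINT x|lborel. r x * fourier_integral w x)"
proof -
  have [measurable]: "r \<in> borel_measurable borel" "w \<in> borel_measurable borel" using r w by auto
  let ?k = "\<lambda>x \<xi>. r x * exp (- (\<i> * complex_of_real x * complex_of_real \<xi>)) * w \<xi>"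
  have "integrable (lborel \<Otimes>\<^sub>M lborel) (case_prod ?k)"
  proof (rule lborel_pair.Fubini_integrable)
    show "case_prod ?k \<in> borel_measurable (lborel \<Otimes>\<^sub>M lborel)" by measurable
    show "integrable lborel (\<lambda>x. LINT \<xi>|lborel. norm (case_prod ?k (x, \<xi>)))"
      using r by (simp add: norm_mult)
    have "integrable lborel (\<lambda>\<xi>. ?k x \<xi>)" for x
      by (rule Bochner_Integration.integrable_bound[OF integrable_mult_right[OF w, of "r x"]])
        (auto simp: norm_mult)
    then show "AE x in lborel. integrable lborel (\<lambda>\<xi>. case_prod ?k (x, \<xi>))" by simp
  qed
  then have F: "(LINT \<xi>|lborel. LINT x|lborel. ?k x \<xi>) = (LINT x|lborel. LINT \<xi>|lborel. ?k x \<xi>)"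
    by (rule lborel_pair.Fubini_integral)
  have inner_r: "(LINT x|lborel. ?k x \<xi>)
      = (LINT x|lborel. r x * exp (- (\<i> * complex_of_real x * complex_of_real \<xi>))) * w \<xi>" for \<xi>
    by (rule integral_mult_left_zero)
  have inner_w: "(LINT \<xi>|lborel. ?k x \<xi>)
      = r x * (LINT \<xi>|lborel. w \<xi> * exp (- (\<i> * complex_of_real \<xi> * complex_of_real x)))" for x
    by (subst integral_mult_right_zero[symmetric]) (simp add: mult_ac)
  have "(LINT \<xi>|lborel. fourier_integral r \<xi> * w \<xi>)
      = complex_of_real (1 / sqrt (2 * pi)) * (LINT \<xi>|lborel. LINT x|lborel. ?k x \<xi>)"
    unfolding inner_r fourier_integral_def
    by (simp only: mult.assoc[of "complex_of_real (1 / sqrt (2 * pi))"] integral_mult_right_zero)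
  also have "\<dots> = (LINT x|lborel. complex_of_real (1 / sqrt (2 * pi)) * (LINT \<xi>|lborel. ?k x \<xi>))"
    unfolding F by (rule integral_mult_right_zero[symmetric])
  also have "\<dots> = (LINT x|lborel. r x * fourier_integral w x)"
    unfolding inner_w fourier_integral_def by (simp only: mult.left_commute)
  finally show ?thesis .
qed

text \<open>
  By unitarity and by the multiplication formula, \<open>U f\<close> and the Fourier integral of \<open>f\<close> have the same
  integrals against all \<open>gauss_fun (\<i> * t)\<close>. Their difference times \<open>gauss_fun 0\<close> is integrable, although
  the Fourier integral is at this stage only known to be bounded, so its Fourier transform vanishes identically.
\<close>
lemma unitary_extends_fourier_integral:
  assumes U: "unitary U" "\<And>c. U (gauss c) = gauss_transform c"
    and f: "integrable lborel (rep_L2 f)"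
  shows "AE \<xi> in lborel. rep_L2 (U f) \<xi> = fourier_integral (rep_L2 f) \<xi>"
proof -
  let ?r = "rep_L2 f"
  let ?d = "\<lambda>\<xi>. rep_L2 (U f) \<xi> - fourier_integral ?r \<xi>"
  have [measurable]: "?r \<in> borel_measurable borel" using f by auto
  have cnj_gauss: "cnj (gauss_fun c x) = gauss_fun (cnj c) x" for c x
    by (simp add: gauss_fun_def exp_cnj)
  have i1: "integrable lborel (\<lambda>\<xi>. rep_L2 (U f) \<xi> * gauss_fun c \<xi>)" for c
    using integrable_mult_cnj[OF sq_integrable_rep_L2 sq_integrable_gauss_fun, of "U f" "cnj c"]
    by (simp add: cnj_gauss)
  have i2: "integrable lborel (\<lambda>\<xi>. fourier_integral ?r \<xi> * gauss_fun c \<xi>)" for c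
    by (rule Bochner_Integration.integrable_bound[OF
          integrable_mult_right[OF integrable_gauss_fun[of c], of "complex_of_real (LINT x|lborel. cmod (?r x))"]])
      (auto simp: norm_mult intro!: mult_right_mono order_trans[OF fourier_integral_bounded[OF f]])
  have "AE \<xi> in lborel. ?d \<xi> * gauss_fun 0 \<xi> = 0"
  proof (rule fourier_injective)
    show "integrable lborel (\<lambda>\<xi>. ?d \<xi> * gauss_fun 0 \<xi>)"
      using i1 i2 by (simp add: left_diff_distrib)
    fix t
    let ?t = "complex_of_real t"
    have "cinner (U f) (gauss_transform ?t) = cinner f (gauss ?t)"
      using U by (metis unitary_def)
    moreover have "cinner (U f) (gauss_transform ?t)
        = exp (?t\<^sup>2 / 2) * (LINT \<xi>|lborel. rep_L2 (U f) \<xi> * gauss_fun (\<i> * t) \<xi>)"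
      using cinner_abs_L2[OF sq_integrable_rep_L2 sq_integrable_gauss_fun, of "U f" "- \<i> * ?t"]
      by (simp add: gauss_transform_def cinner_scaleC_right exp_cnj gauss_def cnj_gauss)
    moreover have "cinner f (gauss ?t) = (LINT x|lborel. ?r x * gauss_fun ?t x)"
      using cinner_abs_L2[OF sq_integrable_rep_L2 sq_integrable_gauss_fun, of f "?t"]
      by (simp add: gauss_def cnj_gauss)
    moreover have "(LINT \<xi>|lborel. fourier_integral ?r \<xi> * gauss_fun (\<i> * t) \<xi>)
        = exp (- ?t\<^sup>2 / 2) * (LINT x|lborel. ?r x * gauss_fun ?t x)"
      by (subst fourier_integral_multiplication[OF f integrable_gauss_fun])
        (simp add: fourier_integral_gauss_fun power_mult_distrib mult.left_commute
          flip: integral_mult_right_zero mult.assoc)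
    ultimately have "exp (?t\<^sup>2 / 2) * (LINT \<xi>|lborel. rep_L2 (U f) \<xi> * gauss_fun (\<i> * t) \<xi>)
        = exp (?t\<^sup>2 / 2) * (LINT \<xi>|lborel. fourier_integral ?r \<xi> * gauss_fun (\<i> * t) \<xi>)"
      by (simp add: exp_minus field_simps)
    then have "(LINT \<xi>|lborel. rep_L2 (U f) \<xi> * gauss_fun (\<i> * t) \<xi>)
        = (LINT \<xi>|lborel. fourier_integral ?r \<xi> * gauss_fun (\<i> * t) \<xi>)"
      by simp
    then have "(LINT \<xi>|lborel. ?d \<xi> * gauss_fun (\<i> * t) \<xi>) = 0"
      using i1 i2 by (simp add: left_diff_distrib)
    moreover have "?d \<xi> * gauss_fun 0 \<xi> * iexp (t * \<xi>) = ?d \<xi> * gauss_fun (\<i> * t) \<xi>" for \<xi>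
      by (simp add: gauss_fun_imaginary)
    ultimately show "(LINT \<xi>|lborel. ?d \<xi> * gauss_fun 0 \<xi> * iexp (t * \<xi>)) = 0"
      by (simp only:)
  qed
  then show ?thesis by eventually_elim (simp add: gauss_fun_def)
qed

text \<open>
  Two unitary operators that extend the Fourier integral agree on the Gaussians, which are integrable, and
  therefore everywhere; this makes the definite description in the definition of \<open>fourier\<close> meaningful.
\<close>
lemma fourier_properties:
  shows unitary_fourier: "unitary fourier"
    and fourier_eq_integral: "integrable lborel (rep_L2 f) \<Longrightarrow>
      AE \<xi> in lborel. rep_L2 (fourier f) \<xi> = fourier_integral (rep_L2 f) \<xi>"
proof -
  let ?P = "\<lambda>U. unitary U \<and> (\<forall>f. integrable lborel (rep_L2 f) \<longrightarrow>
        (AE \<xi> in lborel. rep_L2 (U f) \<xi> = fourier_integral (rep_L2 f) \<xi>))"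
  obtain U where U: "unitary U" "\<And>c. U (gauss c) = gauss_transform c"
    using unitary_gauss_transform by blast
  have PU: "?P U" using U unitary_extends_fourier_integral by blast
  have "V = U" if V: "?P V" for V
  proof
    fix f
    have rep: "AE x in lborel. gauss_fun c x = rep_L2 (gauss c) x" for c
      using rep_abs_L2[OF sq_integrable_gauss_fun[of c]] unfolding gauss_def by eventually_elim simp
    have "integrable lborel (rep_L2 (gauss c))" for c
      by (rule integrable_cong_AE_imp[OF integrable_gauss_fun _ rep]) simp
    then have ae: "AE \<xi> in lborel. rep_L2 (V (gauss c)) \<xi> = fourier_integral (rep_L2 (gauss c)) \<xi>"
       "AE \<xi> in lborel. rep_L2 (U (gauss c)) \<xi> = fourier_integral (rep_L2 (gauss c)) \<xi>" for c
      using V PU by blast+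
    have eq: "V (gauss c) = U (gauss c)" for c
      unfolding L2_eq_iff using ae[of c] by eventually_elim simp
    show "V f = U f"
      by (rule bounded_linear_eq_on_total[OF _ _ total_gauss_scaled])
        (use V PU eq in \<open>auto intro: unitary_bounded_linear simp: unitary_def\<close>)
  qed
  then have "fourier = U"
    unfolding fourier_def using PU by (intro the_equality) blast+
  then show "unitary fourier" "integrable lborel (rep_L2 f) \<Longrightarrow>
      AE \<xi> in lborel. rep_L2 (fourier f) \<xi> = fourier_integral (rep_L2 f) \<xi>"
    using PU by blast+
qed

section \<open>Entire functions of Gaussian growth\<close>

text \<open>
  The sector of slope \<open>t < 1\<close> has half-angle \<open>\<alpha> < \<pi> / 4\<close>, so there is room for an exponent \<open>p > 2\<close>
  with \<open>p * \<alpha> < \<pi> / 2\<close>: the factor \<open>exp (- \<epsilon> * (1 + z) powr p)\<close> then beats growth of order \<open>2\<close> and has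
  modulus at most \<open>1\<close>. Shifting the base by \<open>1\<close> keeps the power holomorphic at the vertex.
\<close>
lemma phragmen_lindelof_sector:
  fixes f :: "complex \<Rightarrow> complex" and t M C c :: real
  defines "S \<equiv> {z. \<bar>Im z\<bar> \<le> t * Re z}"
  assumes t: "0 < t" "t < 1"
    and U: "open U" "S \<subseteq> U" and hol: "f holomorphic_on U"
    and growth: "\<And>z. z \<in> S \<Longrightarrow> cmod (f z) \<le> C * exp (c * (cmod z)\<^sup>2)"
    and bdry: "\<And>z. \<bar>Im z\<bar> = t * Re z \<Longrightarrow> cmod (f z) \<le> M"
    and z: "z \<in> S"
  shows "cmod (f z) \<le> M"
proof (rule field_le_epsilon)
  fix e :: real assume e: "e > 0"
  define M' where "M' = M + e"
  have "0 \<le> cmod (f 0)" by simp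
  also have "\<dots> \<le> M" by (rule bdry) simp
  finally have M': "M' > 0" using e by (simp add: M'_def)
  define \<alpha> where "\<alpha> = arctan t"
  have \<alpha>: "0 < \<alpha>" "\<alpha> < pi / 4"
    using t arctan_monotone[of t 1] by (auto simp: \<alpha>_def arctan_one)
  have "2 < pi / 2 / \<alpha>" using \<alpha> by (simp add: field_simps)
  then obtain p where p: "2 < p" "p < pi / 2 / \<alpha>" using dense by blast
  have p\<alpha>: "p * \<alpha> < pi / 2" "0 < p * \<alpha>" using p \<alpha> by (auto simp: field_simps)
  define \<kappa> where "\<kappa> = cos (p * \<alpha>)"
  have \<kappa>: "\<kappa> > 0" unfolding \<kappa>_def using p\<alpha> by (intro cos_gt_zero_pi) auto
  have re: "0 \<le> Re z" if "z \<in> S" for z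
    using that t abs_ge_zero[of "Im z"] unfolding S_def
    by (metis (lifting) mem_Collect_eq mult_less_0_iff not_less order_trans)
  have mult: "\<kappa> * cmod z powr p \<le> Re ((1 + z) powr p)" if zS: "z \<in> S" for z
  proof -
    let ?w = "1 + z"
    have r: "Re ?w \<ge> 1" using re[OF zS] by simp
    have w0: "?w \<noteq> 0" using r by (metis not_one_le_zero zero_complex.simps(1))
    have "\<bar>Im ?w / Re ?w\<bar> \<le> t"
    proof -
      have "\<bar>Im ?w\<bar> \<le> t * Re z" using zS by (simp add: S_def)
      also have "\<dots> \<le> t * Re ?w" using t by simp
      finally show ?thesis using r by (simp add: field_simps abs_divide)
    qed
    then have "\<bar>arctan (Im ?w / Re ?w)\<bar> \<le> \<alpha>"
      unfolding \<alpha>_def using arctan_le_iff arctan_minus by (metis abs_le_iff minus_le_iff)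
    then have arg: "\<bar>Im (Ln ?w)\<bar> \<le> \<alpha>" using r by (subst Im_Ln_eq) (auto simp: w0)
    have "\<bar>p * Im (Ln ?w)\<bar> \<le> p * \<alpha>" using arg p by (simp add: abs_mult)
    then have "\<kappa> \<le> cos \<bar>p * Im (Ln ?w)\<bar>"
      unfolding \<kappa>_def using p\<alpha> by (intro cos_monotone_0_pi_le) auto
    then have cs: "\<kappa> \<le> cos (p * Im (Ln ?w))" by simp
    have "\<kappa> * cmod z powr p \<le> \<kappa> * cmod ?w powr p"
    proof (intro mult_left_mono powr_mono2)
      have "(cmod z)\<^sup>2 \<le> (cmod ?w)\<^sup>2"
        using re[OF zS] by (simp add: cmod_power2 power2_sum)
      then show "cmod z \<le> cmod ?w" by (rule power2_le_imp_le) simp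
    qed (use \<kappa> p in auto)
    also have "\<dots> \<le> cos (p * Im (Ln ?w)) * cmod ?w powr p"
      using cs by (intro mult_right_mono) auto
    also have "\<dots> = Re (?w powr p)"
      using w0 by (simp add: powr_def Re_exp mult.commute)
    finally show ?thesis .
  qed
  have damped: "cmod (f z) * exp (- \<epsilon> * Re ((1 + z) powr p)) \<le> M'" if \<epsilon>: "\<epsilon> > 0" for \<epsilon>
  proof -
    define g where "g z = f z * exp (- \<epsilon> * (1 + z) powr p)" for z :: complex
    have ng: "cmod (g z) = cmod (f z) * exp (- \<epsilon> * Re ((1 + z) powr p))" for z
      by (simp add: g_def norm_mult)
    \<comment> \<open>on large circles the damping factor wins\<close>
    have "((\<lambda>r. C * exp (c * r\<^sup>2 - \<epsilon> * (\<kappa> * r powr p))) \<longlongrightarrow> 0) at_top"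
    proof -
      define d where "d = p - 2"
      define k where "k = \<epsilon> * \<kappa>"
      have "d > 0" "k > 0" using p \<epsilon> \<kappa> by (auto simp: d_def k_def)
      then have "((\<lambda>r. C * exp (c * r\<^sup>2 - k * r powr (2 + d))) \<longlongrightarrow> 0) at_top"
        by real_asymp
      then show ?thesis by (simp add: d_def k_def mult.assoc)
    qed
    then have "\<forall>\<^sub>F r in at_top. C * exp (c * r\<^sup>2 - \<epsilon> * (\<kappa> * r powr p)) < M'"
      using M' order_tendstoD(2) by blast
    then obtain R0 where R0: "\<And>r. r \<ge> R0 \<Longrightarrow> C * exp (c * r\<^sup>2 - \<epsilon> * (\<kappa> * r powr p)) < M'"
      by (auto simp: eventually_at_top_linorder)
    define R where "R = max (max R0 1) (cmod z)"
    define K where "K = S \<inter> cball 0 R"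
    have clS: "closed S" unfolding S_def
      by (intro closed_Collect_le continuous_intros)
    have clK: "closed K" unfolding K_def using clS by (intro closed_Int) auto
    have Kpos: "0 < Re (1 + z)" if "z \<in> K" for z using re that by (fastforce simp: K_def)
    define V where "V = U \<inter> {z. 0 < Re (1 + z)}"
    have KV: "K \<subseteq> V" using Kpos U(2) unfolding V_def K_def by auto
    have "f holomorphic_on V" by (rule holomorphic_on_subset[OF hol]) (auto simp: V_def)
    moreover have "(\<lambda>z. (1 + z) powr complex_of_real p) holomorphic_on V"
      by (intro holomorphic_intros) (auto simp: V_def complex_nonpos_Reals_iff)
    ultimately have holg: "g holomorphic_on V"
      unfolding g_def by (intro holomorphic_on_mult holomorphic_on_exp' holomorphic_on_const)
    have "cmod (g z) \<le> M'"
    proof (rule maximum_modulus_frontier[where S = K and f = g and \<xi> = z])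
      show "g holomorphic_on interior K"
        using holg KV interior_subset by (metis holomorphic_on_subset subset_trans)
      show "continuous_on (closure K) g"
        using holg KV clK by (metis closure_closed holomorphic_on_imp_continuous_on holomorphic_on_subset)
      show "bounded K" by (simp add: K_def bounded_Int)
      show "z \<in> K" using z by (auto simp: K_def R_def)
      fix w assume w: "w \<in> frontier K"
      then have wK: "w \<in> K" using clK frontier_subset_eq by blast
      then have wS: "w \<in> S" by (simp add: K_def)
      have pos: "0 \<le> Re ((1 + w) powr p)"
        using mult[OF wS] \<kappa> by (meson order_trans mult_nonneg_nonneg less_imp_le powr_ge_zero)
      consider "\<bar>Im w\<bar> = t * Re w" | "cmod w = R"
      proof -
        have "\<not> (\<bar>Im w\<bar> < t * Re w \<and> cmod w < R)"
        proof
          assume "\<bar>Im w\<bar> < t * Re w \<and> cmod w < R"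
          moreover have "open ({w. \<bar>Im w\<bar> < t * Re w} \<inter> ball 0 R)"
            by (intro open_Int open_Collect_less continuous_intros) auto
          moreover have "{w. \<bar>Im w\<bar> < t * Re w} \<inter> ball 0 R \<subseteq> K" by (auto simp: K_def S_def)
          ultimately have "w \<in> interior K" by (intro interiorI) auto
          then show False using w by (simp add: frontier_def)
        qed
        then show ?thesis using wK that by (force simp: K_def S_def)
      qed
      then show "cmod (g w) \<le> M'"
      proof cases
        case 1
        have "cmod (g w) \<le> cmod (f w) * 1"
          unfolding ng using pos \<epsilon> by (intro mult_left_mono) auto
        then show ?thesis using bdry[OF 1] e by (simp add: M'_def)
      next
        case 2
        have "cmod (g w) \<le> (C * exp (c * (cmod w)\<^sup>2)) * exp (- \<epsilon> * (\<kappa> * cmod w powr p))"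
          unfolding ng using growth[OF wS] mult[OF wS] \<epsilon>
          by (intro mult_mono order_trans[OF norm_ge_zero growth[OF wS]]) auto
        also have "\<dots> = C * exp (c * R\<^sup>2 - \<epsilon> * (\<kappa> * R powr p))"
          by (simp add: 2 exp_diff exp_minus field_simps)
        also have "\<dots> \<le> M'" by (rule less_imp_le[OF R0]) (simp add: R_def)
        finally show ?thesis .
      qed
    qed
    then show ?thesis by (simp add: ng)
  qed
  have "((\<lambda>\<epsilon>. cmod (f z) * exp (- \<epsilon> * Re ((1 + z) powr p))) \<longlongrightarrow>
      cmod (f z) * exp (- 0 * Re ((1 + z) powr p))) (at_right 0)"
    by (intro tendsto_intros)
  then have "cmod (f z) * exp (- 0 * Re ((1 + z) powr p)) \<le> M'"
  proof (rule tendsto_upperbound)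
    show "\<forall>\<^sub>F \<epsilon> in at_right 0. cmod (f z) * exp (- \<epsilon> * Re ((1 + z) powr p)) \<le> M'"
      using eventually_at_right_less[of 0] by (rule eventually_mono) (rule damped)
  qed simp
  then show "cmod (f z) \<le> M + e" by (simp add: M'_def)
qed

text \<open>
  A quadrant has the critical opening for growth of order \<open>2\<close>: the function \<open>exp (- \<i> * z\<^sup>2)\<close> has modulus
  \<open>1\<close> on both axes and is unbounded inside. What excludes it is that the growth is controlled by \<open>Re z\<close>,
  which is small near the imaginary axis. In the sector between the positive real axis and a ray of large
  slope, \<open>exp (\<i> * B * z\<^sup>2)\<close> has modulus \<open>1\<close> on the axis, and \<open>B\<close> can be chosen so that it cancels
  \<open>exp ((Re z)\<^sup>2 / 2)\<close> on the ray. As the ray approaches the imaginary axis, \<open>B\<close> tends to \<open>0\<close>.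
  Multiplication by \<open>u = 1 + \<i> * t\<close> carries the symmetric sector of slope \<open>t\<close> to the sector between the
  real axis and the ray of slope \<open>2 * t / (1 - t\<^sup>2)\<close>.
\<close>
lemma quadrant_bound:
  fixes f :: "complex \<Rightarrow> complex" and M :: real
  assumes U: "open U" "{z. 0 \<le> Re z \<and> 0 \<le> Im z} \<subseteq> U" and hol: "f holomorphic_on U"
    and growth: "\<And>z. 0 \<le> Re z \<Longrightarrow> 0 \<le> Im z \<Longrightarrow> cmod (f z) \<le> M * exp ((Re z)\<^sup>2 / 2)"
    and axis: "\<And>x. 0 \<le> x \<Longrightarrow> cmod (f (complex_of_real x)) \<le> M"
    and z: "0 \<le> Re z" "0 \<le> Im z"
  shows "cmod (f z) \<le> M"
proof (cases "Re z = 0")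
  case True
  then show ?thesis using growth[OF z] by simp
next
  case False
  then have x0: "Re z > 0" using z by simp
  have M0: "M \<ge> 0" using axis[of 0] norm_ge_zero order_trans by blast
  have slope: "cmod (f z) \<le> M * exp (2 * ((1 - t\<^sup>2) / (8 * t)) * Re z * Im z)"
    if t: "0 < t" "t < 1" and tz: "Im z * (1 - t\<^sup>2) \<le> 2 * t * Re z" for t
  proof -
    define B where "B = (1 - t\<^sup>2) / (8 * t)"
    have t2: "t\<^sup>2 < 1" using t by (simp add: power_less_one_iff)
    have B: "B > 0" using t t2 by (simp add: B_def)
    define u where "u = Complex 1 t"
    have u0: "u \<noteq> 0" by (simp add: u_def complex_eq_iff)
    define g where "g v = f (u * v) * exp (\<i> * B * (u * v)\<^sup>2)" for v :: complex
    have Re_uv: "Re (u * v) = Re v - t * Im v" and Im_uv: "Im (u * v) = t * Re v + Im v" for v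
      by (auto simp: u_def)
    have Rexp: "Re (\<i> * B * w\<^sup>2) = - 2 * B * (Re w * Im w)" for w
      by (simp add: power2_eq_square algebra_simps)
    have ng: "cmod (g v) = cmod (f (u * v)) * exp (- 2 * B * (Re (u * v) * Im (u * v)))" for v
      unfolding g_def norm_mult[of "f _"] norm_exp_eq_Re Rexp ..
    have quad: "0 \<le> Re (u * v) \<and> 0 \<le> Im (u * v)" if "\<bar>Im v\<bar> \<le> t * Re v" for v
    proof -
      have "0 \<le> t * Re v" using that by linarith
      then have r: "0 \<le> Re v" using t by (simp add: zero_le_mult_iff)
      have "t * Im v \<le> t * (t * Re v)" using that t by (intro mult_left_mono) auto
      also have "\<dots> = t\<^sup>2 * Re v" by (simp add: power2_eq_square)
      also have "\<dots> \<le> 1 * Re v" using r t2 by (intro mult_right_mono) auto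
      finally show ?thesis using that unfolding Re_uv Im_uv by auto
    qed
    define v where "v = z / u"
    have uv: "u * v = z" using u0 by (simp add: v_def)
    have "cmod (g v) \<le> M"
    proof (rule phragmen_lindelof_sector[where f = g and z = v and t = t and C = M and c = "(1 + t\<^sup>2) / 2" and U = "(*) u -` U"])
      show "open ((*) u -` U)" by (intro open_vimage U continuous_intros)
      show "{v. \<bar>Im v\<bar> \<le> t * Re v} \<subseteq> (*) u -` U" using quad U(2) by blast
      have "(f \<circ> (*) u) holomorphic_on (*) u -` U"
        by (rule holomorphic_on_compose_gen[OF _ hol]) (auto intro!: holomorphic_intros)
      then show "g holomorphic_on (*) u -` U"
        unfolding g_def o_def by (intro holomorphic_on_mult holomorphic_on_exp' holomorphic_on_power holomorphic_on_const holomorphic_on_ident)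
      show "cmod (g v) \<le> M * exp ((1 + t\<^sup>2) / 2 * (cmod v)\<^sup>2)" if "v \<in> {v. \<bar>Im v\<bar> \<le> t * Re v}" for v
      proof -
        have q: "0 \<le> Re (u * v)" "0 \<le> Im (u * v)" using quad that by auto
        have "cmod (g v) \<le> cmod (f (u * v)) * 1"
          unfolding ng using q B by (intro mult_left_mono) (auto intro!: mult_nonneg_nonneg simp del: Re_uv Im_uv)
        also have "\<dots> \<le> M * exp ((Re (u * v))\<^sup>2 / 2)" using growth[OF q] by simp
        also have "\<dots> \<le> M * exp ((cmod (u * v))\<^sup>2 / 2)"
          using M0 by (intro mult_left_mono) (auto simp: cmod_power2)
        also have "(cmod (u * v))\<^sup>2 / 2 = (1 + t\<^sup>2) / 2 * (cmod v)\<^sup>2"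
          by (simp add: norm_mult power_mult_distrib u_def cmod_power2)
        finally show ?thesis .
      qed
      show "cmod (g v) \<le> M" if v: "\<bar>Im v\<bar> = t * Re v" for v
      proof -
        have q: "0 \<le> Re (u * v)" "0 \<le> Im (u * v)" using quad v by auto
        consider "Im v = - t * Re v" | "Im v = t * Re v" using v by linarith
        then show ?thesis
        proof cases
          case 1
          then have im0: "Im (u * v) = 0" unfolding Im_uv 1 by simp
          then have "u * v = complex_of_real (Re (u * v))" by (simp add: complex_eq_iff)
          then show ?thesis using axis[OF q(1)] unfolding ng im0 by simp
        next
          case 2
          \<comment> \<open>the choice of B: on this ray 2 * B * Re w * Im w equals half the square of Re w\<close>
          have e: "4 * B * Im (u * v) = Re (u * v)"
            unfolding Re_uv Im_uv 2 using t by (simp add: B_def field_simps power2_eq_square)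
          have "- 2 * B * (Re (u * v) * Im (u * v)) = - (Re (u * v) * (4 * B * Im (u * v))) / 2"
            by (simp add: algebra_simps)
          also have "\<dots> = - (Re (u * v))\<^sup>2 / 2" unfolding e by (simp add: power2_eq_square)
          finally have "cmod (g v) = cmod (f (u * v)) * exp (- (Re (u * v))\<^sup>2 / 2)"
            unfolding ng by simp
          also have "\<dots> \<le> M * exp ((Re (u * v))\<^sup>2 / 2) * exp (- (Re (u * v))\<^sup>2 / 2)"
            by (intro mult_right_mono growth q) auto
          also have "\<dots> = M" by (simp add: mult.assoc flip: exp_add)
          finally show ?thesis .
        qed
      qed
      show "v \<in> {v. \<bar>Im v\<bar> \<le> t * Re v}"
      proof -
        have n: "1 + t\<^sup>2 > 0" by (simp add: add_pos_nonneg)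
        have rv: "Re v = (Re z + t * Im z) / (1 + t\<^sup>2)" and iv: "Im v = (Im z - t * Re z) / (1 + t\<^sup>2)"
          by (auto simp: v_def u_def Re_divide Im_divide mult.commute)
        have "\<bar>Im z - t * Re z\<bar> \<le> t * (Re z + t * Im z)"
          using tz z t by (auto simp: abs_le_iff algebra_simps power2_eq_square)
        then show ?thesis using n by (simp add: rv iv abs_divide divide_right_mono)
      qed
    qed (use t in auto)
    then have "cmod (f z) * exp (- 2 * B * (Re z * Im z)) \<le> M" unfolding ng uv .
    then have "cmod (f z) \<le> M * exp (2 * B * (Re z * Im z))"
      by (simp add: exp_minus field_simps)
    then show ?thesis by (simp add: B_def mult.assoc)
  qed
  have "((\<lambda>t. M * exp (2 * ((1 - t\<^sup>2) / (8 * t)) * Re z * Im z)) \<longlongrightarrow>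
      M * exp (2 * ((1 - 1\<^sup>2) / (8 * 1)) * Re z * Im z)) (at_left 1)"
    by (intro tendsto_intros) auto
  then have lim: "((\<lambda>t. M * exp (2 * ((1 - t\<^sup>2) / (8 * t)) * Re z * Im z)) \<longlongrightarrow> M) (at_left 1)"
    by simp
  have "((\<lambda>t. 2 * t * Re z - Im z * (1 - t\<^sup>2)) \<longlongrightarrow> 2 * 1 * Re z - Im z * (1 - 1\<^sup>2)) (at_left 1)"
    by (intro tendsto_intros)
  then have "\<forall>\<^sub>F t in at_left 1. 0 < 2 * t * Re z - Im z * (1 - t\<^sup>2)"
    by (rule order_tendstoD) (use x0 in auto)
  moreover have "\<forall>\<^sub>F t in at_left 1. t \<in> {0<..<1::real}"
    by (rule eventually_at_left_real) simp
  ultimately have "\<forall>\<^sub>F t in at_left 1. cmod (f z) \<le> M * exp (2 * ((1 - t\<^sup>2) / (8 * t)) * Re z * Im z)"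
    by eventually_elim (rule slope, auto)
  then show ?thesis by (rule tendsto_lowerbound[OF lim]) simp
qed

lemma entire_linear_growth:
  fixes H :: "complex \<Rightarrow> complex"
  assumes hol: "H holomorphic_on UNIV" and gr: "\<And>z. cmod (H z) \<le> M * (1 + cmod z)"
  shows "deriv H z = deriv H 0"
proof -
  have M: "0 \<le> M" using order_trans[OF norm_ge_zero gr[of 0]] by simp
  have lin: "H \<xi> = H 0 + deriv H 0 * \<xi>" for \<xi>
  proof -
    have "H \<xi> = (\<Sum>k\<le>1. (deriv ^^ k) H 0 / fact k * \<xi> ^ k)"
    proof (rule Liouville_polynomial[OF hol, where A = 1 and B = "2 * M"])
      fix z :: complex assume z: "1 \<le> norm z"
      have "cmod (H z) \<le> M * (1 + cmod z)" by (rule gr)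
      also have "\<dots> \<le> M * (2 * cmod z)" using z M by (intro mult_left_mono) auto
      finally show "cmod (H z) \<le> 2 * M * cmod z ^ 1" by simp
    qed
    also have "\<dots> = H 0 + deriv H 0 * \<xi>" by simp
    finally show ?thesis .
  qed
  have "deriv H z = deriv (\<lambda>\<xi>. H 0 + deriv H 0 * \<xi>) z"
    using lin by (intro arg_cong[where f = "\<lambda>h. deriv h z"] ext)
  also have "\<dots> = deriv H 0"
    by (rule DERIV_imp_deriv) (auto intro!: derivative_eq_intros)
  finally show ?thesis .
qed

text \<open>
  The quotient \<open>H z / (1 + z)\<close> satisfies the hypotheses of \<open>quadrant_bound\<close>: integrating the growth bound
  along the segment from \<open>0\<close> to \<open>z\<close> costs only a factor \<open>\<bar>z\<bar> \<le> \<bar>1 + z\<bar>\<close>.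
\<close>
lemma entire_gaussian_quadrant_growth:
  fixes G H :: "complex \<Rightarrow> complex"
  assumes H: "\<And>z. (H has_field_derivative G z) (at z)" and H0: "H 0 = 0"
    and growth: "\<And>z. cmod (G z) \<le> C * exp ((Re z)\<^sup>2 / 2)"
    and axis: "\<And>x. cmod (H (complex_of_real x)) \<le> D * (1 + \<bar>x\<bar>)"
    and z: "0 \<le> Re z" "0 \<le> Im z"
  shows "cmod (H z) \<le> max C D * (1 + cmod z)"
proof -
  let ?M = "max C D"
  have C0: "0 \<le> C" using order_trans[OF norm_ge_zero growth[of 0]] by simp
  have "cmod (H z / (1 + z)) \<le> ?M"
  proof (rule quadrant_bound[where f = "\<lambda>z. H z / (1 + z)" and z = z and U = "{z. 0 < Re (1 + z)}"])
    show "open {z. 0 < Re (1 + z)}" by (intro open_Collect_less continuous_intros)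
    show "{z. 0 \<le> Re z \<and> 0 \<le> Im z} \<subseteq> {z. 0 < Re (1 + z)}" by auto
    have "H holomorphic_on {z. 0 < Re (1 + z)}"
      using H by (meson field_differentiable_at_within field_differentiable_def holomorphic_on_def)
    then show "(\<lambda>z. H z / (1 + z)) holomorphic_on {z. 0 < Re (1 + z)}"
      by (intro holomorphic_on_divide holomorphic_on_add holomorphic_on_const holomorphic_on_ident)
        (auto simp: complex_eq_iff)
    show "0 \<le> Re z" "0 \<le> Im z" by (rule z)+
  next
    fix z assume q: "0 \<le> Re z" "0 \<le> Im z"
    have "(cmod z)\<^sup>2 \<le> (cmod (1 + z))\<^sup>2" using q by (simp add: cmod_power2 power2_sum)
    then have le: "cmod z \<le> cmod (1 + z)" by (rule power2_le_imp_le) simp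
    have pos: "0 < cmod (1 + z)" using q by (auto simp: complex_eq_iff)
    have "cmod (H z - H 0) \<le> C * exp ((Re z)\<^sup>2 / 2) * cmod (z - 0)"
    proof (rule field_differentiable_bound[where S = "closed_segment 0 z" and f' = G])
      fix w assume "w \<in> closed_segment 0 z"
      then obtain s where s: "0 \<le> s" "s \<le> 1" "w = s *\<^sub>R z" by (auto simp: in_segment)
      show "(H has_field_derivative G w) (at w within closed_segment 0 z)"
        using H by (rule has_field_derivative_at_within)
      have "Re w \<le> Re z" "0 \<le> Re w" using s q by (auto simp: mult_left_le_one_le)
      then have "(Re w)\<^sup>2 \<le> (Re z)\<^sup>2" by (intro power_mono)
      then have "C * exp ((Re w)\<^sup>2 / 2) \<le> C * exp ((Re z)\<^sup>2 / 2)"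
        using C0 by (intro mult_left_mono) auto
      then show "cmod (G w) \<le> C * exp ((Re z)\<^sup>2 / 2)" using growth[of w] by linarith
    qed auto
    then have "cmod (H z) \<le> C * exp ((Re z)\<^sup>2 / 2) * cmod z" by (simp add: H0)
    also have "\<dots> \<le> ?M * exp ((Re z)\<^sup>2 / 2) * cmod (1 + z)"
      using le C0 by (intro mult_mono) auto
    finally show "cmod (H z / (1 + z)) \<le> ?M * exp ((Re z)\<^sup>2 / 2)"
      using pos by (simp add: norm_divide pos_divide_le_eq)
  next
    fix x :: real assume x: "0 \<le> x"
    have n: "cmod (1 + complex_of_real x) = 1 + x"
      using x by (metis abs_of_nonneg add_nonneg_nonneg norm_of_real of_real_1 of_real_add zero_le_one)
    have "cmod (H (complex_of_real x)) \<le> D * (1 + x)" using axis[of x] x by simp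
    also have "\<dots> \<le> ?M * (1 + x)" using x by (intro mult_right_mono) auto
    finally show "cmod (H (complex_of_real x) / (1 + complex_of_real x)) \<le> ?M" using x by (simp add: norm_divide n pos_divide_le_eq)
  qed
  moreover have "0 < cmod (1 + z)" using z by (auto simp: complex_eq_iff)
  ultimately have "cmod (H z) \<le> ?M * cmod (1 + z)" by (simp add: norm_divide pos_divide_le_eq)
  also have "\<dots> \<le> ?M * (1 + cmod z)"
    using C0 norm_triangle_ineq[of 1 z] by (intro mult_left_mono) auto
  finally show ?thesis .
qed

text \<open>
  Square integrability gives no pointwise bound on \<open>G\<close> along the real line, but it bounds the growth of a
  primitive \<open>H\<close> linearly, because \<open>\<bar>G\<bar> \<le> \<bar>G\<bar>\<^sup>2 + 1\<close>. The hypotheses are stable under \<open>z \<mapsto> - z\<close> and under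
  complex conjugation, which reduces the four quadrants to one.
\<close>
lemma entire_gaussian_growth_square_integrable_zero:
  fixes G :: "complex \<Rightarrow> complex"
  assumes hol: "G holomorphic_on UNIV"
    and growth: "\<And>z. cmod (G z) \<le> C * exp ((Re z)\<^sup>2 / 2)"
    and sq: "integrable lborel (\<lambda>x. (cmod (G (complex_of_real x)))\<^sup>2)"
  shows "G z = 0"
proof -
  obtain H0 where "\<And>x. x \<in> UNIV \<Longrightarrow> (H0 has_field_derivative G x) (at x within UNIV)"
    using holomorphic_convex_primitive'[of UNIV G] hol by auto
  then have H0: "(H0 has_field_derivative G x) (at x)" for x by simp
  define H where "H z = H0 z - H0 0" for z
  have H: "(H has_field_derivative G x) (at x)" for x
    unfolding H_def using DERIV_diff[OF H0 DERIV_const] by simp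
  have Hz: "H 0 = 0" by (simp add: H_def)
  define N where "N = (LINT x|lborel. (cmod (G (complex_of_real x)))\<^sup>2)"
  have N0: "0 \<le> N" by (simp add: N_def)
  have contG: "continuous_on A (\<lambda>x. G (complex_of_real x))" for A :: "real set"
    using holomorphic_on_imp_continuous_on[OF hol]
    by (intro continuous_on_compose2[OF _ continuous_on_of_real_id]) auto
  have interval: "cmod (H (complex_of_real b) - H (complex_of_real a)) \<le> N + (b - a)" if ab: "a \<le> b" for a b
  proof -
    have eq: "H (complex_of_real b) - H (complex_of_real a)
        = (LINT x|lborel. indicator {a..b} x *\<^sub>R G (complex_of_real x))"
      by (rule integral_FTC_atLeastAtMost[symmetric, OF ab _ contG])
        (rule has_vector_derivative_real_field[OF H])
    have i: "integrable lborel (\<lambda>x. (cmod (G (complex_of_real x)))\<^sup>2 + indicator {a..b} x)"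
      by (intro Bochner_Integration.integrable_add sq integrable_real_indicator)
        (auto simp: emeasure_lborel_Icc_eq)
    have "cmod (H (complex_of_real b) - H (complex_of_real a))
        \<le> (LINT x|lborel. norm (indicator {a..b} x *\<^sub>R G (complex_of_real x)))"
      unfolding eq by (rule integral_norm_bound)
    also have "\<dots> \<le> (LINT x|lborel. (cmod (G (complex_of_real x)))\<^sup>2 + indicator {a..b} x)"
    proof (rule integral_mono'[OF i])
      fix x :: real
      have "0 \<le> (cmod (G (complex_of_real x)) - 1)\<^sup>2 + cmod (G (complex_of_real x))" by simp
      then have "cmod (G (complex_of_real x)) \<le> (cmod (G (complex_of_real x)))\<^sup>2 + 1"
        by (simp add: power2_diff)
      then show "norm (indicator {a..b} x *\<^sub>R G (complex_of_real x))
          \<le> (cmod (G (complex_of_real x)))\<^sup>2 + indicator {a..b} x"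
        by (cases "x \<in> {a..b}") simp_all
    qed auto
    also have "\<dots> = N + (b - a)" using sq ab by (simp add: N_def)
    finally show ?thesis .
  qed
  have axis: "cmod (H (complex_of_real x)) \<le> (N + 1) * (1 + \<bar>x\<bar>)" for x
  proof -
    have "cmod (H (complex_of_real x)) \<le> N + \<bar>x\<bar>"
      using interval[of 0 x] interval[of x 0] by (cases "0 \<le> x") (auto simp: Hz)
    also have "\<dots> \<le> (N + 1) * (1 + \<bar>x\<bar>)" using N0 by (simp add: algebra_simps)
    finally show ?thesis .
  qed
  let ?M = "max C (N + 1)"
  define P where "P G H \<longleftrightarrow> (\<forall>z. (H has_field_derivative G z) (at z)) \<and> H 0 = 0 \<and>
    (\<forall>z. cmod (G z) \<le> C * exp ((Re z)\<^sup>2 / 2)) \<and>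
    (\<forall>x. cmod (H (complex_of_real x)) \<le> (N + 1) * (1 + \<bar>x\<bar>))" for G H :: "complex \<Rightarrow> complex"
  have P_cnj: "P (cnj \<circ> G \<circ> cnj) (cnj \<circ> H \<circ> cnj)" if "P G H" for G H
    unfolding P_def
  proof (intro conjI allI)
    have PH: "(H has_field_derivative G z) (at z)" for z using that by (simp add: P_def)
    show "((cnj \<circ> H \<circ> cnj) has_field_derivative (cnj \<circ> G \<circ> cnj) z) (at z)" for z
      using has_field_derivative_cnj_cnj[OF PH] by (simp add: o_def)
    have "cmod (G (cnj z)) \<le> C * exp ((Re (cnj z))\<^sup>2 / 2)" for z
      using that unfolding P_def by blast
    then show "cmod ((cnj \<circ> G \<circ> cnj) z) \<le> C * exp ((Re z)\<^sup>2 / 2)" for z by simp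
  qed (use that in \<open>simp_all add: P_def\<close>)
  have P_uminus: "P (\<lambda>z. G (- z)) (\<lambda>z. - H (- z))" if "P G H" for G H
    unfolding P_def
  proof (intro conjI allI)
    have PH: "(H has_field_derivative G z) (at z)" for z using that by (simp add: P_def)
    show "((\<lambda>z. - H (- z)) has_field_derivative G (- z)) (at z)" for z
      using DERIV_minus[OF DERIV_chain2[OF PH DERIV_minus[OF DERIV_ident]]] by simp
    have "cmod (G (- z)) \<le> C * exp ((Re (- z))\<^sup>2 / 2)" for z
      using that unfolding P_def by blast
    then show "cmod (G (- z)) \<le> C * exp ((Re z)\<^sup>2 / 2)" for z by simp
    have "cmod (H (complex_of_real (- x))) \<le> (N + 1) * (1 + \<bar>- x\<bar>)" for x
      using that unfolding P_def by blast
    then show "cmod (- H (- complex_of_real x)) \<le> (N + 1) * (1 + \<bar>x\<bar>)" for x by simp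
  qed (use that in \<open>simp add: P_def\<close>)
  have quadrant: "cmod (H z) \<le> ?M * (1 + cmod z)" if P: "P G H" and z: "0 \<le> Re z" "0 \<le> Im z" for G H z
    by (rule entire_gaussian_quadrant_growth[of H G, OF _ _ _ _ z]) (use P in \<open>simp_all only: P_def\<close>)
  have half_plane: "cmod (H z) \<le> ?M * (1 + cmod z)" if P: "P G H" and z: "0 \<le> Re z" for G H z
  proof (cases "0 \<le> Im z")
    case True
    then show ?thesis by (rule quadrant[OF P z])
  next
    case False
    have "cmod ((cnj \<circ> H \<circ> cnj) (cnj z)) \<le> ?M * (1 + cmod (cnj z))"
      by (rule quadrant[OF P_cnj[OF P]]) (use z False in simp_all)
    then show ?thesis by (simp only: o_def complex_cnj_cnj complex_mod_cnj)
  qed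
  have P: "P G H" unfolding P_def using H Hz growth axis by blast
  have "cmod (H z) \<le> ?M * (1 + cmod z)" for z
  proof (cases "0 \<le> Re z")
    case True
    then show ?thesis by (rule half_plane[OF P])
  next
    case False
    have "cmod (- H (- (- z))) \<le> ?M * (1 + cmod (- z))"
      by (rule half_plane[OF P_uminus[OF P]]) (use False in simp)
    then show ?thesis by (simp only: minus_minus norm_minus_cancel)
  qed
  moreover have "H holomorphic_on UNIV"
    using H by (auto simp: holomorphic_on_def field_differentiable_def)
  ultimately have "deriv H z = deriv H 0" for z by (intro entire_linear_growth)
  then have const: "G z = G 0" for z
    using DERIV_imp_deriv[OF H, of z] DERIV_imp_deriv[OF H, of 0] by (metis (no_types))
  have "(\<lambda>x. (cmod (G (complex_of_real x)))\<^sup>2) = (\<lambda>x. (cmod (G 0))\<^sup>2)"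
    by (rule ext) (subst const, rule refl)
  then have "integrable lborel (\<lambda>x::real. (cmod (G 0))\<^sup>2)"
    using sq by simp
  then have "G 0 = 0" by (auto simp: integrable_iff_bounded ennreal_mult_less_top)
  then show ?thesis by (subst const)
qed

section \<open>The Cowling--Price theorem\<close>

lemma cmod_cinner_le: "cmod (cinner F G) \<le> norm F * norm (G :: L2)"
proof (cases "cinner F G = 0")
  case False
  let ?z = "cinner F G"
  have "(cmod ?z)\<^sup>2 = inner (cnj ?z *\<^sub>C F) G"
    by (simp add: inner_L2_eq_Re cinner_scaleC_left complex_norm_square[symmetric] mult.commute flip: of_real_power)
  also have "\<dots> \<le> norm (cnj ?z *\<^sub>C F) * norm G" by (rule norm_cauchy_schwarz)
  also have "\<dots> = cmod ?z * (norm F * norm G)" by (simp add: norm_scaleC)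
  finally show ?thesis using False by (simp add: power2_eq_square)
qed simp

lemma cmod_gauss_fun: "cmod (gauss_fun w x) = exp (- x\<^sup>2 / 2 + Re w * x)"
  by (simp add: gauss_fun_def flip: of_real_power)

lemma norm_gauss: "norm (gauss w) = sqrt (sqrt pi) * exp ((Re w)\<^sup>2 / 2)"
proof -
  have "complex_of_real ((norm (gauss w))\<^sup>2) = complex_of_real (sqrt pi) * exp ((w + cnj w)\<^sup>2 / 4)"
    unfolding cinner_self[symmetric] cinner_gauss ..
  also have "(w + cnj w)\<^sup>2 / 4 = complex_of_real ((Re w)\<^sup>2)"
    by (simp add: complex_add_cnj power_mult_distrib)
  finally have "(norm (gauss w))\<^sup>2 = sqrt pi * exp ((Re w)\<^sup>2)"
    by (simp only: exp_of_real of_real_mult[symmetric] of_real_eq_iff)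
  also have "\<dots> = (sqrt (sqrt pi) * exp ((Re w)\<^sup>2 / 2))\<^sup>2"
    by (simp add: power_mult_distrib flip: exp_double)
  finally show ?thesis by (simp add: power2_eq_iff_nonneg)
qed

text \<open>
  The two-sided Laplace transform of \<open>exp (- x\<^sup>2 / 2) * H\<close>, that is, the Segal--Bargmann transform in a
  scaling without the Gaussian prefactor; on the imaginary axis it is a multiple of the Fourier transform.
\<close>
definition bargmann :: "L2 \<Rightarrow> complex \<Rightarrow> complex" where
  "bargmann H w = cinner H (gauss (cnj w))"

lemma bargmann_eq_integral: "bargmann H w = (LINT x|lborel. rep_L2 H x * gauss_fun w x)"
  using cinner_abs_L2[OF sq_integrable_rep_L2 sq_integrable_gauss_fun, of H "cnj w"]
  by (simp add: bargmann_def gauss_def gauss_fun_def exp_cnj)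

lemma bargmann_growth: "cmod (bargmann H w) \<le> norm H * sqrt (sqrt pi) * exp ((Re w)\<^sup>2 / 2)"
  using cmod_cinner_le[of H "gauss (cnj w)"] by (simp add: bargmann_def norm_gauss mult.assoc)

lemma integrable_rep_gauss_fun: "integrable lborel (\<lambda>x. rep_L2 H x * gauss_fun w x)"
  using integrable_mult_cnj[OF sq_integrable_rep_L2 sq_integrable_gauss_fun, of H "cnj w"]
  by (simp add: gauss_fun_def exp_cnj)

lemma cmod_exp_minus_1_le: "cmod (exp u - 1) \<le> cmod u * exp (cmod u)"
proof -
  have "cmod (exp u - exp 0) \<le> exp (cmod u) * cmod (u - 0)"
  proof (rule field_differentiable_bound[where S = "closed_segment 0 u" and f' = exp])
    fix v assume "v \<in> closed_segment 0 u"
    then have "cmod v \<le> cmod u" by (auto simp: in_segment mult_left_le_one_le)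
    then show "cmod (exp v) \<le> exp (cmod u)"
      using complex_Re_le_cmod[of v] by (simp add: norm_exp_eq_Re)
    show "(exp has_field_derivative exp v) (at v within closed_segment 0 u)"
      by (rule DERIV_subset[OF DERIV_exp]) simp
  qed auto
  then show ?thesis by (simp add: mult.commute)
qed

text \<open>
  Differentiation under the integral sign. The difference quotients along a sequence converging to \<open>w\<close> are
  dominated by \<open>\<bar>H\<bar>\<close> times two Gaussians with real parameters \<open>R\<close> and \<open>- R\<close>.
\<close>
lemma bargmann_entire: "bargmann H holomorphic_on UNIV"
proof -
  have "(bargmann H has_field_derivative (LINT x|lborel. rep_L2 H x * gauss_fun w x * complex_of_real x)) (at w)"
    (is "(_ has_field_derivative ?D) _") for w
    unfolding has_field_derivative_iff tendsto_at_iff_sequentially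
  proof (intro allI impI)
    fix X :: "nat \<Rightarrow> complex"
    assume Xne: "\<forall>i. X i \<in> UNIV - {w}" and X: "X \<longlonglongrightarrow> w"
    define s where "s i = X i - w" for i
    have s0: "s i \<noteq> 0" for i using Xne by (auto simp: s_def)
    have s: "s \<longlonglongrightarrow> 0" using tendsto_diff[OF X tendsto_const[of w]] by (simp add: s_def[abs_def])
    then obtain K where K: "\<And>i. cmod (s i) \<le> K"
      using convergent_imp_Bseq[of s] by (metis BseqE convergentI)
    \<comment> \<open>the summand 1 absorbs the factor x from the derivative of the exponential\<close>
    define R where "R = \<bar>Re w\<bar> + K + 1"
    define q where "q i x = rep_L2 H x * gauss_fun w x * ((exp (s i * complex_of_real x) - 1) / s i)" for i x
    define g where "g x = cmod (rep_L2 H x * gauss_fun R x) + cmod (rep_L2 H x * gauss_fun (- R) x)" for x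
    have qeq: "((\<lambda>v. (bargmann H v - bargmann H w) / (v - w)) \<circ> X) i = (LINT x|lborel. q i x)" for i
    proof -
      have "gauss_fun (X i) x = gauss_fun w x * exp (s i * complex_of_real x)" for x
        by (simp add: gauss_fun_def s_def algebra_simps flip: exp_add)
      then have "q i x = (rep_L2 H x * gauss_fun (X i) x - rep_L2 H x * gauss_fun w x) / s i" for x
        by (simp add: q_def algebra_simps diff_divide_distrib)
      then show ?thesis
        by (simp add: bargmann_eq_integral integrable_rep_gauss_fun s_def)
    qed
    have "(\<lambda>i. LINT x|lborel. q i x) \<longlonglongrightarrow> ?D"
    proof (rule integral_dominated_convergence)
      show "integrable lborel g"
        unfolding g_def by (intro Bochner_Integration.integrable_add integrable_norm integrable_rep_gauss_fun)
      show "AE x in lborel. (\<lambda>i. q i x) \<longlonglongrightarrow> rep_L2 H x * gauss_fun w x * complex_of_real x"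
      proof (rule AE_I2)
        fix x
        have "((\<lambda>v. exp (v * complex_of_real x)) has_field_derivative complex_of_real x) (at 0)"
          by (auto intro!: derivative_eq_intros)
        then have "(\<lambda>i. (exp (s i * complex_of_real x) - 1) / s i) \<longlonglongrightarrow> complex_of_real x"
          unfolding has_field_derivative_iff tendsto_at_iff_sequentially
          using s s0 by (auto simp: o_def)
        then show "(\<lambda>i. q i x) \<longlonglongrightarrow> rep_L2 H x * gauss_fun w x * complex_of_real x"
          unfolding q_def by (intro tendsto_intros)
      qed
      show "AE x in lborel. norm (q i x) \<le> g x" for i
      proof (rule AE_I2)
        fix x
        have "cmod ((exp (s i * complex_of_real x) - 1) / s i)
            \<le> cmod (s i * complex_of_real x) * exp (cmod (s i * complex_of_real x)) / cmod (s i)"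
          unfolding norm_divide by (intro divide_right_mono cmod_exp_minus_1_le) simp
        also have "\<dots> = \<bar>x\<bar> * exp (cmod (s i) * \<bar>x\<bar>)" using s0[of i] by (simp add: norm_mult)
        also have "\<dots> \<le> exp \<bar>x\<bar> * exp (K * \<bar>x\<bar>)"
        proof -
          have "\<bar>x\<bar> \<le> exp \<bar>x\<bar>" using exp_ge_add_one_self[of "\<bar>x\<bar>"] by linarith
          then show ?thesis
            using K[of i] by (intro mult_mono) (auto intro!: mult_right_mono)
        qed
        finally have quot: "cmod ((exp (s i * complex_of_real x) - 1) / s i) \<le> exp ((K + 1) * \<bar>x\<bar>)"
          by (simp add: algebra_simps flip: exp_add)
        have "Re w * x \<le> \<bar>Re w\<bar> * \<bar>x\<bar>" by (metis abs_ge_self abs_mult)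
        then have "exp (- x\<^sup>2 / 2 + Re w * x) * exp ((K + 1) * \<bar>x\<bar>) \<le> exp (- x\<^sup>2 / 2 + R * \<bar>x\<bar>)"
          by (simp add: R_def algebra_simps flip: exp_add)
        also have "\<dots> \<le> exp (- x\<^sup>2 / 2 + R * x) + exp (- x\<^sup>2 / 2 + - R * x)"
          by (cases "0 \<le> x") auto
        finally have gR: "cmod (gauss_fun w x) * exp ((K + 1) * \<bar>x\<bar>) \<le> cmod (gauss_fun R x) + cmod (gauss_fun (- R) x)"
          by (simp add: cmod_gauss_fun)
        have "norm (q i x) \<le> cmod (rep_L2 H x) * (cmod (gauss_fun w x) * exp ((K + 1) * \<bar>x\<bar>))"
          unfolding q_def norm_mult mult.assoc by (intro mult_left_mono quot) auto
        also have "\<dots> \<le> cmod (rep_L2 H x) * (cmod (gauss_fun R x) + cmod (gauss_fun (- R) x))"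
          by (intro mult_left_mono gR) auto
        finally show "norm (q i x) \<le> g x" by (simp add: g_def norm_mult distrib_left)
      qed
    qed (auto simp: q_def)
    moreover have "((\<lambda>v. (bargmann H v - bargmann H w) / (v - w)) \<circ> X) = (\<lambda>i. LINT x|lborel. q i x)"
      by (rule ext) (rule qeq)
    ultimately show "((\<lambda>v. (bargmann H v - bargmann H w) / (v - w)) \<circ> X) \<longlonglongrightarrow> ?D"
      by (simp only:)
  qed
  then show ?thesis
    by (auto simp: holomorphic_on_def field_differentiable_def)
qed

lemma sq_integrable_gauss_mult:
  assumes "sq_integrable f"
  shows "sq_integrable (\<lambda>x. gauss_fun 0 x * f x)"
  unfolding sq_integrable_def
proof
  have [measurable]: "f \<in> borel_measurable lborel" using assms by (simp add: sq_integrable_def)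
  show "(\<lambda>x. gauss_fun 0 x * f x) \<in> borel_measurable lborel" by measurable
  have g1: "cmod (gauss_fun 0 x) \<le> 1" for x unfolding cmod_gauss_fun by simp
  have le: "cmod (gauss_fun 0 x * f x) \<le> cmod (f x)" for x
    unfolding norm_mult by (rule mult_left_le_one_le[OF norm_ge_zero norm_ge_zero g1])
  have "(cmod (gauss_fun 0 x * f x))\<^sup>2 \<le> (cmod (f x))\<^sup>2" for x
    by (rule power_mono[OF le norm_ge_zero])
  then have ae: "AE x in lborel. norm ((cmod (gauss_fun 0 x * f x))\<^sup>2) \<le> norm ((cmod (f x))\<^sup>2)"
    by (intro AE_I2) (simp only: real_norm_def abs_power2)
  have "integrable lborel (\<lambda>x. (cmod (f x))\<^sup>2)" using assms by (simp add: sq_integrable_def)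
  then show "integrable lborel (\<lambda>x. (cmod (gauss_fun 0 x * f x))\<^sup>2)"
    by (rule Bochner_Integration.integrable_bound[OF _ _ ae]) measurable
qed

lift_definition damp :: "L2 \<Rightarrow> L2" is "\<lambda>f x. gauss_fun 0 x * f x"
  by (auto intro: sq_integrable_gauss_mult)

lemma rep_damp: "AE x in lborel. rep_L2 (damp F) x = gauss_fun 0 x * rep_L2 F x"
proof -
  have "damp F = abs_L2 (\<lambda>x. gauss_fun 0 x * rep_L2 F x)"
    using damp.abs_eq[of "rep_L2 F"] by (simp add: sq_integrable_rep_L2)
  then show ?thesis
    using rep_abs_L2[OF sq_integrable_gauss_mult[OF sq_integrable_rep_L2], of F] by (simp only:)
qed

lemma fourier_damp: "AE \<xi> in lborel. rep_L2 (fourier (damp H)) \<xi> =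
    complex_of_real (1 / sqrt (2 * pi)) * bargmann H (- \<i> * complex_of_real \<xi>)"
proof -
  have i0: "integrable lborel (\<lambda>x. gauss_fun 0 x * rep_L2 H x)"
    using integrable_rep_gauss_fun[of H 0] by (simp add: mult.commute)
  have "integrable lborel (rep_L2 (damp H))"
    by (rule integrable_cong_AE_imp[OF i0]) (use rep_damp[of H] in \<open>auto elim: eventually_mono\<close>)
  then have "AE \<xi> in lborel. rep_L2 (fourier (damp H)) \<xi> = fourier_integral (rep_L2 (damp H)) \<xi>"
    by (rule fourier_eq_integral)
  moreover have "fourier_integral (rep_L2 (damp H)) \<xi>
      = complex_of_real (1 / sqrt (2 * pi)) * bargmann H (- \<i> * complex_of_real \<xi>)" for \<xi>
  proof -
    have "(LINT x|lborel. rep_L2 (damp H) x * exp (- (\<i> * complex_of_real x * complex_of_real \<xi>)))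
        = (LINT x|lborel. rep_L2 H x * gauss_fun (- \<i> * complex_of_real \<xi>) x)"
    proof (rule integral_cong_AE)
      have "gauss_fun (- \<i> * complex_of_real \<xi>) x
          = gauss_fun 0 x * exp (- (\<i> * complex_of_real x * complex_of_real \<xi>))" for x
        by (simp add: gauss_fun_def algebra_simps flip: exp_add)
      then show "AE x in lborel. rep_L2 (damp H) x * exp (- (\<i> * complex_of_real x * complex_of_real \<xi>))
          = rep_L2 H x * gauss_fun (- \<i> * complex_of_real \<xi>) x"
        using rep_damp[of H] by (auto elim!: eventually_mono)
    qed measurable
    then show ?thesis by (simp add: fourier_integral_def bargmann_eq_integral)
  qed
  ultimately show ?thesis by simp
qed

text \<open>
  With Gaussian decay exactly \<open>exp (- x\<^sup>2 / 2)\<close> on both sides this is the borderline case: for any slower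
  decay the Gaussian itself would be a counterexample. Here the Gaussian is excluded because
  \<open>1\<close> is not square integrable.
\<close>
lemma cowling_price:
  assumes eq: "fourier (damp H) = damp K"
  shows "damp H = 0"
proof -
  define G where "G z = exp (z\<^sup>2 / 2) * bargmann H (- \<i> * z)" for z
  have "G z = 0" for z
  proof (rule entire_gaussian_growth_square_integrable_zero[where G = G])
    have "(bargmann H \<circ> (\<lambda>z. - \<i> * z)) holomorphic_on UNIV"
      by (rule holomorphic_on_compose_gen[OF _ bargmann_entire]) (auto intro!: holomorphic_intros)
    then show "G holomorphic_on UNIV"
      unfolding G_def o_def
      by (intro holomorphic_on_mult holomorphic_on_exp' holomorphic_on_divide holomorphic_on_power
          holomorphic_on_ident holomorphic_on_const) auto
    show "cmod (G z) \<le> norm H * sqrt (sqrt pi) * exp ((Re z)\<^sup>2 / 2)" for z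
    proof -
      have "cmod (G z) \<le> exp (((Re z)\<^sup>2 - (Im z)\<^sup>2) / 2) * (norm H * sqrt (sqrt pi) * exp ((Im z)\<^sup>2 / 2))"
        unfolding G_def norm_mult norm_exp_eq_Re
        using bargmann_growth[of H "- \<i> * z"] by (intro mult_mono) (auto simp: Re_power2)
      also have "\<dots> = norm H * sqrt (sqrt pi) * exp ((Re z)\<^sup>2 / 2)"
        by (simp add: diff_divide_distrib exp_diff)
      finally show ?thesis .
    qed
    have ae: "AE x in lborel. 2 * pi * (cmod (rep_L2 K x))\<^sup>2 = (cmod (G (complex_of_real x)))\<^sup>2"
      using fourier_damp[of H] rep_damp[of K] unfolding eq
    proof eventually_elim
      case (elim x)
      have "complex_of_real (sqrt (2 * pi)) * rep_L2 K x
          = exp ((complex_of_real x)\<^sup>2 / 2) * (complex_of_real (sqrt (2 * pi)) * (gauss_fun 0 x * rep_L2 K x))"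
        by (simp add: gauss_fun_def exp_minus)
      also have "\<dots> = G (complex_of_real x)"
        unfolding elim(2)[symmetric] elim(1) by (simp add: G_def)
      finally have "G (complex_of_real x) = complex_of_real (sqrt (2 * pi)) * rep_L2 K x" ..
      then show ?case by (simp add: norm_mult power_mult_distrib)
    qed
    have i: "integrable lborel (\<lambda>x. 2 * pi * (cmod (rep_L2 K x))\<^sup>2)"
      using sq_integrable_rep_L2[of K] by (simp add: sq_integrable_def)
    have "continuous_on UNIV (\<lambda>x. (cmod (G (complex_of_real x)))\<^sup>2)"
      using holomorphic_on_imp_continuous_on[OF \<open>G holomorphic_on UNIV\<close>]
      by (intro continuous_intros continuous_on_compose2[OF _ continuous_on_of_real_id]) auto
    then have m: "(\<lambda>x. (cmod (G (complex_of_real x)))\<^sup>2) \<in> borel_measurable lborel"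
      using borel_measurable_continuous_onI by simp
    show "integrable lborel (\<lambda>x. (cmod (G (complex_of_real x)))\<^sup>2)"
      by (rule integrable_cong_AE_imp[OF i m]) (use ae in \<open>auto elim: eventually_mono\<close>)
  qed
  then have "bargmann H (- \<i> * z) = 0" for z by (simp add: G_def)
  then have "AE \<xi> in lborel. rep_L2 (fourier (damp H)) \<xi> = 0"
    using fourier_damp[of H] by simp
  then have "fourier (damp H) = 0"
    using abs_L2_eq_iff[OF sq_integrable_rep_L2 sq_integrable_zero, of "fourier (damp H)"]
    by (simp add: zero_L2_def)
  then have "cinner (damp H) (damp H) = 0"
    using unitary_fourier by (metis cinner_zero_left unitary_def)
  then show ?thesis by (simp add: cinner_self)
qed

section \<open>The operator \<open>T\<close>\<close>

lemma gauss_fun_inverse: "complex_of_real (exp (x\<^sup>2 / 2)) * (gauss_fun 0 x * z) = z"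
  by (simp add: gauss_fun_def exp_minus mult.assoc[symmetric] flip: exp_of_real)

lemma sq_integrable_cong_AE:
  assumes "sq_integrable f" "g \<in> borel_measurable lborel" "AE x in lborel. f x = g x"
  shows "sq_integrable g"
  unfolding sq_integrable_def
proof
  show "integrable lborel (\<lambda>x. (cmod (g x))\<^sup>2)"
  proof (rule integrable_cong_AE_imp)
    show "integrable lborel (\<lambda>x. (cmod (f x))\<^sup>2)" using assms(1) by (simp add: sq_integrable_def)
    show "AE x in lborel. (cmod (f x))\<^sup>2 = (cmod (g x))\<^sup>2" using assms(3) by eventually_elim simp
  qed (use assms(2) in measurable)
qed (fact assms)

lemma A_op_damp: "damp H \<in> op_dom A_op" "op_app A_op (damp H) = H"
proof -
  let ?g = "\<lambda>x. complex_of_real (exp (x\<^sup>2 / 2)) * rep_L2 (damp H) x"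
  have ae: "AE x in lborel. rep_L2 H x = ?g x"
    using rep_damp[of H] by eventually_elim (simp add: gauss_fun_inverse)
  have sq: "sq_integrable ?g"
    by (rule sq_integrable_cong_AE[OF sq_integrable_rep_L2 _ ae]) measurable
  then show "damp H \<in> op_dom A_op" by (simp add: A_op_def)
  have "abs_L2 (rep_L2 H) = abs_L2 ?g"
    using ae by (subst abs_L2_eq_iff) (auto simp: sq_integrable_rep_L2 sq)
  then show "op_app A_op (damp H) = H" by (simp add: A_op_def)
qed

text \<open>
  Multiplication by \<open>exp (x\<^sup>2 / 2)\<close> is the inverse of \<open>damp\<close>. In particular the inverse of \<open>A\<close> is
  the everywhere defined operator \<open>damp\<close>, and the domain of \<open>T\<close> is that of \<open>B\<close>.
\<close>
lemma dom_A_op: "op_dom A_op = range damp"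
proof
  show "op_dom A_op \<subseteq> range damp"
  proof
    fix f assume "f \<in> op_dom A_op"
    then have sq: "sq_integrable (\<lambda>x. complex_of_real (exp (x\<^sup>2 / 2)) * rep_L2 f x)"
      by (simp add: A_op_def)
    have "damp (abs_L2 (\<lambda>x. complex_of_real (exp (x\<^sup>2 / 2)) * rep_L2 f x))
        = abs_L2 (\<lambda>x. gauss_fun 0 x * (complex_of_real (exp (x\<^sup>2 / 2)) * rep_L2 f x))"
      using sq by (simp add: damp.abs_eq)
    also have "(\<lambda>x. gauss_fun 0 x * (complex_of_real (exp (x\<^sup>2 / 2)) * rep_L2 f x)) = rep_L2 f"
      by (rule ext, subst mult.left_commute) (rule gauss_fun_inverse)
    finally show "f \<in> range damp" by (metis abs_rep_L2 rangeI)
  qed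
qed (use A_op_damp(1) in auto)

lemma damp_eq_iff: "damp H = damp K \<longleftrightarrow> H = K"
  by (metis A_op_damp(2))

lemma A_op_inverse: "op_dom (op_inverse A_op) = UNIV" "op_app (op_inverse A_op) H = damp H"
proof -
  show "op_dom (op_inverse A_op) = UNIV"
    using image_eqI[where f = "op_app A_op", OF A_op_damp(2)[symmetric] A_op_damp(1)] by (auto simp: op_inverse_def)
  have "inj_on (op_app A_op) (op_dom A_op)"
    unfolding dom_A_op by (rule inj_onI) (auto simp: A_op_damp(2))
  then have "inv_into (op_dom A_op) (op_app A_op) (op_app A_op (damp H)) = damp H"
    using A_op_damp(1) by (rule inv_into_f_f)
  then show "op_app (op_inverse A_op) H = damp H"
    by (simp add: op_inverse_def A_op_damp(2))
qed

lemma cinner_ext: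
  assumes "\<And>x. cinner x y = cinner x (z :: L2)"
  shows "y = z"
proof -
  have "cinner (y - z) (y - z) = 0"
    using assms[of "y - z"] cinner_commute[of "y - z"]
    by (metis cinner_commute cinner_diff_left cancel_comm_monoid_add_class.diff_cancel complex_cnj_zero)
  then show ?thesis by (simp add: cinner_self)
qed

lemma zero_if_cinner_zero:
  assumes "\<And>x. cinner x (y :: L2) = 0"
  shows "y = 0"
  by (rule cinner_ext) (simp add: assms)

abbreviation ifourier :: "L2 \<Rightarrow> L2" where
  "ifourier \<equiv> inv fourier"

lemma inj_fourier: "fourier x = fourier y \<longleftrightarrow> x = y"
proof
  assume "fourier x = fourier y"
  moreover have "cinner (fourier z) (fourier x) = cinner z x" "cinner (fourier z) (fourier y) = cinner z y" for z
    using unitary_fourier by (auto simp: unitary_def)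
  ultimately show "x = y" by (intro cinner_ext) metis
qed simp

lemma fourier_ifourier [simp]: "fourier (ifourier y) = y"
  using unitary_fourier by (simp add: unitary_def surj_f_inv_f)

lemma ifourier_fourier [simp]: "ifourier (fourier x) = x"
  by (simp flip: inj_fourier)

lemma cinner_fourier: "cinner (fourier x) y = cinner x (ifourier y)"
  using unitary_fourier by (metis fourier_ifourier unitary_def)

lemma cinner_ifourier: "cinner (ifourier x) y = cinner x (fourier y)"
  using cinner_fourier by (metis fourier_ifourier ifourier_fourier)

lemma fourier_add: "fourier (x + y) = fourier x + fourier y"
  and fourier_scaleC: "fourier (c *\<^sub>C x) = c *\<^sub>C fourier x"
  using unitary_fourier by (auto simp: unitary_def)

lemma ifourier_add: "ifourier (x + y) = ifourier x + ifourier y"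
  and ifourier_scaleC: "ifourier (c *\<^sub>C x) = c *\<^sub>C ifourier x"
  by (simp_all flip: inj_fourier add: fourier_add fourier_scaleC)

lemma F_op_simps: "op_dom F_op = UNIV" "op_app F_op = fourier"
  by (simp_all add: F_op_def)

lemma F_op_adjoint: "op_dom (op_adjoint F_op) = UNIV" "op_app (op_adjoint F_op) y = ifourier y"
proof -
  show "op_dom (op_adjoint F_op) = UNIV"
    by (auto simp: op_adjoint_def F_op_simps cinner_fourier)
  have "(THE z. \<forall>x. cinner (fourier x) y = cinner x z) = ifourier y"
    by (rule the_equality) (auto simp: cinner_fourier intro: cinner_ext[symmetric])
  then show "op_app (op_adjoint F_op) y = ifourier y"
    by (simp add: op_adjoint_def F_op_simps)
qed

lemma damp_add: "damp (x + y) = damp x + damp y"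
  by transfer (auto intro!: sq_integrable_gauss_mult sq_integrable_add simp: distrib_left)

lemma damp_scaleC: "damp (c *\<^sub>C x) = c *\<^sub>C damp x"
  by transfer (auto intro!: sq_integrable_gauss_mult sq_integrable_scale simp: mult.left_commute)

lemma cinner_damp: "cinner (damp x) y = cinner x (damp y)"
proof transfer
  fix f g :: "real \<Rightarrow> complex"
  have "cnj (gauss_fun 0 x) = gauss_fun 0 x" for x by (simp add: gauss_fun_def exp_cnj)
  then show "(LINT x|lborel. gauss_fun 0 x * f x * cnj (g x)) = (LINT x|lborel. f x * cnj (gauss_fun 0 x * g x))"
    by (simp add: mult_ac)
qed

lemma damp_zero [simp]: "damp 0 = 0"
  using damp_add[of 0 0] by simp

lemma ifourier_zero [simp]: "ifourier 0 = 0"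
  using ifourier_add[of 0 0] by simp

text \<open>
  A linear bijection from \<open>L2\<close> onto the domain of \<open>T\<close>.
\<close>
definition dom_param :: "L2 \<Rightarrow> L2" where
  "dom_param H = ifourier (damp H)"

lemma dom_param_add: "dom_param (x + y) = dom_param x + dom_param y"
  and dom_param_scaleC: "dom_param (c *\<^sub>C x) = c *\<^sub>C dom_param x"
  by (simp_all add: dom_param_def damp_add damp_scaleC ifourier_add ifourier_scaleC)

lemma dom_param_zero [simp]: "dom_param 0 = 0"
  by (simp add: dom_param_def)

lemma dom_T_op: "op_dom T_op = range dom_param"
proof -
  have "op_dom T_op = {x. fourier x \<in> range damp}"
    by (simp add: T_op_def B_op_def op_mult_def A_op_inverse F_op_adjoint F_op_simps dom_A_op)
  also have "\<dots> = range dom_param"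
    unfolding dom_param_def by (auto simp: image_iff) (metis ifourier_fourier)
  finally show ?thesis .
qed

lemma T_op_dom_param: "op_app T_op (dom_param H) = damp (ifourier H)"
  by (simp add: T_op_def B_op_def op_mult_def A_op_inverse F_op_adjoint F_op_simps A_op_damp dom_param_def)

lemma linear_T_op: "linear_operator T_op"
proof -
  have *: "0 \<in> range dom_param" by (metis dom_param_zero rangeI)
  show ?thesis
    unfolding linear_operator_def csubspace_def dom_T_op
    using * by (auto simp: T_op_dom_param ifourier_add ifourier_scaleC damp_add damp_scaleC
        simp flip: dom_param_add dom_param_scaleC)
qed

text \<open>
  Orthogonality to the domain of \<open>T\<close> says \<open>damp (fourier y) = 0\<close>, because \<open>damp\<close> is self-adjoint.
\<close>
lemma inner_dom_T_op_zero:
  assumes "\<And>x. x \<in> op_dom T_op \<Longrightarrow> inner x y = 0"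
  shows "y = 0"
proof -
  have "cinner (dom_param H) y = 0" for H
    using assms by (intro cinner_zero_if_inner_scaleC_zero) (simp add: dom_T_op flip: dom_param_scaleC)
  then have "cinner H (damp (fourier y)) = 0" for H
    by (simp add: dom_param_def cinner_ifourier cinner_damp)
  then have "damp (fourier y) = damp 0" by (simp add: zero_if_cinner_zero)
  then have "fourier y = 0" by (simp only: damp_eq_iff)
  then show "y = 0" by (metis ifourier_fourier ifourier_zero)
qed

lemma csubspace_subspace: "csubspace (S :: L2 set) \<Longrightarrow> subspace S"
  by (auto simp: csubspace_def subspace_def scaleR_scaleC)

lemma densely_defined_T_op: "densely_defined T_op"
  unfolding densely_defined_def
  by (rule subspace_dense)
    (use linear_T_op inner_dom_T_op_zero in \<open>auto simp: linear_operator_def intro: csubspace_subspace\<close>)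

lemma dom_T_op_squared: "op_dom (T_op \<circ>\<^sub>o T_op) = {0}"
proof
  show "op_dom (T_op \<circ>\<^sub>o T_op) \<subseteq> {0}"
  proof
    fix x assume "x \<in> op_dom (T_op \<circ>\<^sub>o T_op)"
    then obtain H K where x: "x = dom_param H" and "damp (ifourier H) = dom_param K"
      by (auto simp: op_mult_def dom_T_op T_op_dom_param)
    then have "fourier (damp (ifourier H)) = damp K" by (simp add: dom_param_def)
    then have "damp (ifourier H) = damp 0" using cowling_price by simp
    then have "ifourier H = 0" by (simp only: damp_eq_iff)
    then have "H = 0" using fourier_ifourier ifourier_fourier ifourier_zero by metis
    then show "x \<in> {0}" by (simp add: x)
  qed
  have "op_app T_op 0 = 0" using T_op_dom_param[of 0] by simp
  moreover have "0 \<in> op_dom T_op" unfolding dom_T_op by (metis dom_param_zero rangeI)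
  ultimately show "{0} \<subseteq> op_dom (T_op \<circ>\<^sub>o T_op)" by (simp add: op_mult_def)
qed

lemma dom_adjoint_T_op: "op_dom (op_adjoint T_op) = {0}"
proof
  show "op_dom (op_adjoint T_op) \<subseteq> {0}"
  proof
    fix y assume "y \<in> op_dom (op_adjoint T_op)"
    then obtain z where z: "\<And>x. x \<in> op_dom T_op \<Longrightarrow> cinner (op_app T_op x) y = cinner x z"
      by (auto simp: op_adjoint_def)
    have "cinner H (fourier (damp y)) = cinner H (damp (fourier z))" for H
      using z[of "dom_param H"]
      by (simp add: T_op_dom_param cinner_damp cinner_ifourier dom_T_op) (simp add: dom_param_def cinner_damp cinner_ifourier)
    then have "fourier (damp y) = damp (fourier z)" by (rule cinner_ext)
    then have "damp y = damp 0" using cowling_price by simp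
    then show "y \<in> {0}" by (simp only: damp_eq_iff singletonI)
  qed
  show "{0} \<subseteq> op_dom (op_adjoint T_op)" by (auto simp: op_adjoint_def intro!: exI[of _ 0])
qed

text \<open>
  A vector \<open>(u, v)\<close> orthogonal to the graph of \<open>T\<close> has \<open>v\<close> in the domain of the adjoint, so \<open>v = 0\<close>, and then
  \<open>u = 0\<close> by density. Thus a closed extension would have the whole product space as its graph, which is
  impossible for a linear operator on a nonzero space.
\<close>
lemma trivial_adjoint_not_closable:
  fixes T :: "L2 operator"
  assumes lin: "linear_operator T" and dense: "densely_defined T" and adj: "op_dom (op_adjoint T) = {0}"
  shows "\<not> closable T"
proof
  assume "closable T"
  then obtain S where S: "linear_operator S" "closed (op_graph S)"
    and ext: "op_dom T \<subseteq> op_dom S" "\<And>x. x \<in> op_dom T \<Longrightarrow> op_app S x = op_app T x"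
    by (auto simp: closable_def closed_operator_def extends_def)
  have scaleR_S: "r *\<^sub>R x \<in> op_dom S \<and> op_app S (r *\<^sub>R x) = r *\<^sub>R op_app S x" if "x \<in> op_dom S" for r x
    using S(1) that by (simp add: linear_operator_def csubspace_def scaleR_scaleC)
  have S0: "0 \<in> op_dom S" "op_app S 0 = 0"
    using S(1) scaleR_S[of 0 0] by (auto simp: linear_operator_def csubspace_def)
  have sub: "subspace (op_graph S)"
    unfolding subspace_def
  proof (intro conjI ballI allI)
    show "0 \<in> op_graph S" using S0 by (force simp: op_graph_def zero_prod_def)
    show "p + q \<in> op_graph S" if "p \<in> op_graph S" "q \<in> op_graph S" for p q
      using S(1) that by (auto simp: op_graph_def linear_operator_def csubspace_def)
    show "r *\<^sub>R p \<in> op_graph S" if "p \<in> op_graph S" for r p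
      using scaleR_S that by (auto simp: op_graph_def)
  qed
  have "op_graph S = UNIV"
  proof (rule closed_subspace_eq_UNIV[OF sub S(2)])
    fix p :: "L2 \<times> L2" assume p: "\<And>q. q \<in> op_graph S \<Longrightarrow> inner q p = 0"
    obtain u v where uv: "p = (u, v)" by (cases p)
    have orth: "inner x u + inner (op_app T x) v = 0" if x: "x \<in> op_dom T" for x
    proof -
      have "(x, op_app T x) \<in> op_graph S"
        using ext(1) ext(2)[OF x] x by (force simp: op_graph_def)
      from p[OF this] show ?thesis by (simp add: uv)
    qed
    have "cinner (op_app T x) v = cinner x (- u)" if x: "x \<in> op_dom T" for x
    proof -
      have "inner (a *\<^sub>C op_app T x) v = inner (a *\<^sub>C x) (- u)" for a
        using orth[of "a *\<^sub>C x"] lin x by (auto simp: linear_operator_def csubspace_def)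
      then show ?thesis by (rule cinner_eqI)
    qed
    then have "v \<in> op_dom (op_adjoint T)" by (auto simp: op_adjoint_def)
    then have v: "v = 0" using adj by simp
    have "op_dom T \<subseteq> {x. inner x u = 0}" using orth by (auto simp: v)
    moreover have "closed {x. inner x u = 0}" by (intro closed_Collect_eq continuous_intros)
    ultimately have "closure (op_dom T) \<subseteq> {x. inner x u = 0}" by (rule closure_minimal)
    moreover have "u \<in> closure (op_dom T)" using dense by (simp add: densely_defined_def)
    ultimately have "inner u u = 0" by blast
    then show "p = 0" using v by (simp add: uv zero_prod_def)
  qed
  then have "(0, gauss 0) \<in> op_graph S" by simp
  then have "gauss 0 = 0" using S0 by (auto simp: op_graph_def)
  then show False using norm_gauss[of 0] by simp
qed

theorem mainTheorem1:
  shows "(linear_operator T_op \<and> densely_defined T_op \<and>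
      op_dom (T_op \<circ>\<^sub>o T_op) = {0} \<and> op_dom (op_adjoint T_op) = {0} \<and>
      paranormal T_op \<and> \<not> closable T_op) \<and>
    (\<exists>S :: L2 operator. linear_operator S \<and> densely_defined S \<and> paranormal S \<and>
      \<not> closable S \<and> op_dom (op_adjoint S) = {0})"
proof -
  have "op_app T_op 0 = 0" using T_op_dom_param[of 0] by simp
  then have "paranormal T_op" by (simp add: paranormal_def dom_T_op_squared)
  then show ?thesis
    using linear_T_op densely_defined_T_op dom_T_op_squared dom_adjoint_T_op
      trivial_adjoint_not_closable[OF linear_T_op densely_defined_T_op dom_adjoint_T_op]
    by blast
qed

end
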